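(* Let $k$ be a commutative ring, $A$ a $k$-algebra and $(V,\rho)\in\mathcal{YD}^{A^e}$ a right Yetter-Drinfeld $A^e$-module. Then the map $$\Omega=\Omega_{(V,\rho)}:V\otimes V\to V\otimes V,\qquad \Omega(v\otimes w)=w_{[0]}\otimes w_{[1]}v,$$ is a solution of the quantum Yang-Baxter equation $\Omega^{12}\Omega^{13}\Omega^{23}=\Omega^{23}\Omega^{13}\Omega^{12}$ in $\mathrm{End}(V\otimes V\otimes V)$. In particular, if $(V,\rho)\in\mathcal{M}^{A\otimes A}$, then the map $$\Omega=\Omega_{(V,\rho)}:V\otimes V\to V\otimes V,\qquad \Omega(v\otimes w)=w_{[0]}\otimes v_{[0]}w_{[1]}v_{[1]},$$ is a solution of the quantum Yang-Baxter equation and satisfies $\Omega^3=\Omega$ in $\mathrm{End}(V\otimes V)$.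
   Context: Conventions: $\otimes=\otimes_k$; algebras are associative and unital; $A$-bimodules are $k$-central, i.e. modules over $A^e=A\otimes A^{\rm op}$; $\mathrm{End}=\mathrm{End}_k$. $\Omega^{ij}$ denotes $\Omega$ acting on the $i$-th and $j$-th tensor factors of $V\otimes V\otimes V$ and as the identity on the remaining factor. An object of $\mathcal{M}^{A\otimes A}$ (right comodule over the Sweedler canonical coring $A\otimes A$) is a right $A$-module $V$ with a $k$-linear map $\rho: V\to V\otimes A$, written $\rho(v)=v_{[0]}\otimes v_{[1]}$ (summation understood), such that for all $v\in V$, $a\in A$: $v_{[0]}v_{[1]}=v$; $\rho(v_{[0]})\otimes v_{[1]}=v_{[0]}\otimes 1\otimes v_{[1]}$ in $V\otimes A\otimes A$; $\rho(va)=v_{[0]}\otimes v_{[1]}a$. An object of $\mathcal{YD}^{A^e}$ is a pair $(V,\rho)$ with $V$ an $A$-bimodule and $(V,\rho)\in\mathcal{M}^{A\otimes A}$ such that for all $a\in A$, $v\in V$: $\rho(av)=v_{[0]}\otimes av_{[1]}$ and $av_{[0]}\otimes v_{[1]}=v_{[0]}a\otimes v_{[1]}$. *)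

theory Defs
  imports HOL.Hull "HOL-Algebra.AbelCoset" "HOL-Algebra.Module"
begin

section \<open>Linear maps and noncommutative algebras over a commutative ring\<close>

definition linear_maps ::
    "('k, 'r) ring_scheme \<Rightarrow> ('k, 'm, 'x) module_scheme \<Rightarrow> ('k, 'n, 'y) module_scheme
      \<Rightarrow> ('m \<Rightarrow> 'n) set" where
  "linear_maps k M N =
    {f \<in> carrier M \<rightarrow> carrier N.
      (\<forall>x\<in>carrier M. \<forall>y\<in>carrier M. f (x \<oplus>\<^bsub>M\<^esub> y) = f x \<oplus>\<^bsub>N\<^esub> f y) \<and>
      (\<forall>c\<in>carrier k. \<forall>x\<in>carrier M. f (c \<odot>\<^bsub>M\<^esub> x) = c \<odot>\<^bsub>N\<^esub> f x)}"

text \<open>The library locale \<^locale>\<open>algebra\<close> covers commutative algebras only.\<close>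

locale assoc_algebra = module k A + ring A for k (structure) and A (structure) +
  assumes smult_mult_left:
      "\<lbrakk>c \<in> carrier k; a \<in> carrier A; b \<in> carrier A\<rbrakk>
        \<Longrightarrow> (c \<odot>\<^bsub>A\<^esub> a) \<otimes>\<^bsub>A\<^esub> b = c \<odot>\<^bsub>A\<^esub> (a \<otimes>\<^bsub>A\<^esub> b)"
    and smult_mult_right:
      "\<lbrakk>c \<in> carrier k; a \<in> carrier A; b \<in> carrier A\<rbrakk>
        \<Longrightarrow> a \<otimes>\<^bsub>A\<^esub> (c \<odot>\<^bsub>A\<^esub> b) = c \<odot>\<^bsub>A\<^esub> (a \<otimes>\<^bsub>A\<^esub> b)"


section \<open>Tensor products of modules\<close>

text \<open>
  The tensor product is the free \<open>k\<close>-module on \<open>carrier M \<times> carrier N\<close> modulo the submodule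
  generated by the bilinearity relations; its elements are cosets. Only the module structure of the
  resulting records is meaningful: their ring multiplication and unit are unspecified.
\<close>

definition free_module :: "('k, 'r) ring_scheme \<Rightarrow> 'b set \<Rightarrow> ('k, 'b \<Rightarrow> 'k) module" where
  "free_module k B =
    \<lparr>carrier = {f. (\<forall>b\<in>B. f b \<in> carrier k) \<and> (\<forall>b. b \<notin> B \<longrightarrow> f b = \<zero>\<^bsub>k\<^esub>) \<and>
                   finite {b. f b \<noteq> \<zero>\<^bsub>k\<^esub>}},
     mult = undefined, one = undefined,
     zero = (\<lambda>b. \<zero>\<^bsub>k\<^esub>), add = (\<lambda>f g b. f b \<oplus>\<^bsub>k\<^esub> g b),
     smult = (\<lambda>c f b. c \<otimes>\<^bsub>k\<^esub> f b)\<rparr>"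

definition basis_vector :: "('k, 'r) ring_scheme \<Rightarrow> 'b \<Rightarrow> 'b \<Rightarrow> 'k" where
  "basis_vector k b = (\<lambda>c. if c = b then \<one>\<^bsub>k\<^esub> else \<zero>\<^bsub>k\<^esub>)"

definition quotient_module ::
    "('k, 'm, 'x) module_scheme \<Rightarrow> 'm set \<Rightarrow> ('k, 'm set) module" where
  "quotient_module M H =
    \<lparr>carrier = a_rcosets\<^bsub>M\<^esub> H,
     mult = undefined, one = undefined,
     zero = H, add = set_add M,
     smult = (\<lambda>c X. \<Union>x\<in>X. H +>\<^bsub>M\<^esub> (c \<odot>\<^bsub>M\<^esub> x))\<rparr>"

context
  fixes k :: "('k, 'r) ring_scheme"
    and M :: "('k, 'm, 'x) module_scheme"
    and N :: "('k, 'n, 'y) module_scheme"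
begin

definition tensor_free :: "('k, 'm \<times> 'n \<Rightarrow> 'k) module" where
  "tensor_free = free_module k (carrier M \<times> carrier N)"

definition bilinear_relators :: "('m \<times> 'n \<Rightarrow> 'k) set" where
  "bilinear_relators =
    (let F = tensor_free; e = (\<lambda>m n. basis_vector k (m, n)) in
      {e (x \<oplus>\<^bsub>M\<^esub> y) n \<ominus>\<^bsub>F\<^esub> (e x n \<oplus>\<^bsub>F\<^esub> e y n) |x y n.
        x \<in> carrier M \<and> y \<in> carrier M \<and> n \<in> carrier N} \<union>
      {e m (x \<oplus>\<^bsub>N\<^esub> y) \<ominus>\<^bsub>F\<^esub> (e m x \<oplus>\<^bsub>F\<^esub> e m y) |m x y.
        m \<in> carrier M \<and> x \<in> carrier N \<and> y \<in> carrier N} \<union>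
      {e (c \<odot>\<^bsub>M\<^esub> m) n \<ominus>\<^bsub>F\<^esub> (c \<odot>\<^bsub>F\<^esub> e m n) |c m n.
        c \<in> carrier k \<and> m \<in> carrier M \<and> n \<in> carrier N} \<union>
      {e m (c \<odot>\<^bsub>N\<^esub> n) \<ominus>\<^bsub>F\<^esub> (c \<odot>\<^bsub>F\<^esub> e m n) |c m n.
        c \<in> carrier k \<and> m \<in> carrier M \<and> n \<in> carrier N})"

definition bilinear_submodule :: "('m \<times> 'n \<Rightarrow> 'k) set" where
  "bilinear_submodule = (\<lambda>H. submodule H k tensor_free) hull bilinear_relators"

definition tensor :: "('k, ('m \<times> 'n \<Rightarrow> 'k) set) module" where
  "tensor = quotient_module tensor_free bilinear_submodule"

definition pure_tensor :: "'m \<Rightarrow> 'n \<Rightarrow> ('m \<times> 'n \<Rightarrow> 'k) set" where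
  "pure_tensor m n = bilinear_submodule +>\<^bsub>tensor_free\<^esub> basis_vector k (m, n)"

end

text \<open>
  \<open>tensor_lift k P f\<close> is the linear map \<open>M \<otimes> N \<rightarrow> P\<close>, \<open>m \<otimes> n \<mapsto> f m n\<close>. It is computed on a
  representative of the coset, so it is meaningful only for \<open>k\<close>-bilinear \<open>f\<close>; then the choice of
  representative does not matter.
\<close>

definition tensor_lift ::
    "('k, 'r) ring_scheme \<Rightarrow> ('k, 'p, 'x) module_scheme \<Rightarrow> ('m \<Rightarrow> 'n \<Rightarrow> 'p)
      \<Rightarrow> ('m \<times> 'n \<Rightarrow> 'k) set \<Rightarrow> 'p" where
  "tensor_lift k P f X =
    (let x = (SOME x. x \<in> X)
     in finsum P (\<lambda>b. x b \<odot>\<^bsub>P\<^esub> f (fst b) (snd b)) {b. x b \<noteq> \<zero>\<^bsub>k\<^esub>})"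

text \<open>\<open>tensor_map k M' N' f g\<close> is \<open>f \<otimes> g\<close>, with values in \<open>M' \<otimes> N'\<close>.\<close>

definition tensor_map ::
    "('k, 'r) ring_scheme \<Rightarrow> ('k, 'm2, 'x) module_scheme \<Rightarrow> ('k, 'n2, 'y) module_scheme
      \<Rightarrow> ('m \<Rightarrow> 'm2) \<Rightarrow> ('n \<Rightarrow> 'n2)
      \<Rightarrow> ('m \<times> 'n \<Rightarrow> 'k) set \<Rightarrow> ('m2 \<times> 'n2 \<Rightarrow> 'k) set" where
  "tensor_map k M' N' f g =
    tensor_lift k (tensor k M' N') (\<lambda>m n. pure_tensor k M' N' (f m) (g n))"

definition tensor_swap ::
    "('k, 'r) ring_scheme \<Rightarrow> ('k, 'm, 'x) module_scheme \<Rightarrow> ('k, 'n, 'y) module_scheme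
      \<Rightarrow> ('m \<times> 'n \<Rightarrow> 'k) set \<Rightarrow> ('n \<times> 'm \<Rightarrow> 'k) set" where
  "tensor_swap k M N = tensor_lift k (tensor k N M) (\<lambda>m n. pure_tensor k N M n m)"

text \<open>\<open>(m \<otimes> n) \<otimes> p \<mapsto> m \<otimes> (n \<otimes> p)\<close> and its inverse.\<close>

definition tensor_assoc ::
    "('k, 'r) ring_scheme \<Rightarrow> ('k, 'm, 'x) module_scheme \<Rightarrow> ('k, 'n, 'y) module_scheme
      \<Rightarrow> ('k, 'p, 'z) module_scheme
      \<Rightarrow> (('m \<times> 'n \<Rightarrow> 'k) set \<times> 'p \<Rightarrow> 'k) set \<Rightarrow> ('m \<times> ('n \<times> 'p \<Rightarrow> 'k) set \<Rightarrow> 'k) set" where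
  "tensor_assoc k M N P =
    (let T = tensor k M (tensor k N P)
     in tensor_lift k T (\<lambda>x p. tensor_lift k T
          (\<lambda>m n. pure_tensor k M (tensor k N P) m (pure_tensor k N P n p)) x))"

definition tensor_assoc_inv ::
    "('k, 'r) ring_scheme \<Rightarrow> ('k, 'm, 'x) module_scheme \<Rightarrow> ('k, 'n, 'y) module_scheme
      \<Rightarrow> ('k, 'p, 'z) module_scheme
      \<Rightarrow> ('m \<times> ('n \<times> 'p \<Rightarrow> 'k) set \<Rightarrow> 'k) set \<Rightarrow> (('m \<times> 'n \<Rightarrow> 'k) set \<times> 'p \<Rightarrow> 'k) set" where
  "tensor_assoc_inv k M N P =
    (let T = tensor k (tensor k M N) P
     in tensor_lift k T (\<lambda>m x. tensor_lift k T
          (\<lambda>n p. pure_tensor k (tensor k M N) P (pure_tensor k M N m n) p) x))"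


section \<open>The quantum Yang--Baxter equation\<close>

text \<open>The threefold tensor power of \<open>V\<close> is bracketed as \<open>(V \<otimes> V) \<otimes> V\<close>.\<close>

context
  fixes k :: "('k, 'r) ring_scheme"
    and V :: "('k, 'v, 'x) module_scheme"
begin

abbreviation tensor_square :: "('k, ('v \<times> 'v \<Rightarrow> 'k) set) module" where
  "tensor_square \<equiv> tensor k V V"

abbreviation tensor_cube :: "('k, (('v \<times> 'v \<Rightarrow> 'k) set \<times> 'v \<Rightarrow> 'k) set) module" where
  "tensor_cube \<equiv> tensor k tensor_square V"

definition leg12 where
  "leg12 (\<Omega> :: ('v \<times> 'v \<Rightarrow> 'k) set \<Rightarrow> ('v \<times> 'v \<Rightarrow> 'k) set) =
    tensor_map k tensor_square V \<Omega> (\<lambda>w :: 'v. w)"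

definition leg23 where
  "leg23 (\<Omega> :: ('v \<times> 'v \<Rightarrow> 'k) set \<Rightarrow> ('v \<times> 'v \<Rightarrow> 'k) set) =
    tensor_assoc_inv k V V V \<circ> tensor_map k V tensor_square (\<lambda>u :: 'v. u) \<Omega>
      \<circ> tensor_assoc k V V V"

definition leg13 where
  "leg13 \<Omega> = leg23 (tensor_swap k V V) \<circ> leg12 \<Omega> \<circ> leg23 (tensor_swap k V V)"

definition qybe_solution :: "(('v \<times> 'v \<Rightarrow> 'k) set \<Rightarrow> ('v \<times> 'v \<Rightarrow> 'k) set) \<Rightarrow> bool" where
  "qybe_solution \<Omega> \<longleftrightarrow>
    \<Omega> \<in> linear_maps k tensor_square tensor_square \<and>
    (\<forall>x\<in>carrier tensor_cube.
      (leg12 \<Omega> \<circ> leg13 \<Omega> \<circ> leg23 \<Omega>) x = (leg23 \<Omega> \<circ> leg13 \<Omega> \<circ> leg12 \<Omega>) x)"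

end


section \<open>Comodules over the Sweedler canonical coring and Yetter--Drinfeld modules\<close>

text \<open>The right action \<open>v a\<close> is written \<open>r v a\<close> and the left action \<open>a v\<close> is written \<open>l a v\<close>.\<close>

locale right_module =
  alg: assoc_algebra k A + mod: module k V
  for k :: "('k, 'r) ring_scheme"
    and A :: "('k, 'a, 'x) module_scheme"
    and V :: "('k, 'v, 'y) module_scheme" +
  fixes r :: "'v \<Rightarrow> 'a \<Rightarrow> 'v"
  assumes right_linear: "a \<in> carrier A \<Longrightarrow> (\<lambda>v. r v a) \<in> linear_maps k V V"
    and right_linear_scalar: "v \<in> carrier V \<Longrightarrow> r v \<in> linear_maps k A V"
    and right_one: "v \<in> carrier V \<Longrightarrow> r v \<one>\<^bsub>A\<^esub> = v"
    and right_mult: "\<lbrakk>v \<in> carrier V; a \<in> carrier A; b \<in> carrier A\<rbrakk>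
      \<Longrightarrow> r v (a \<otimes>\<^bsub>A\<^esub> b) = r (r v a) b"

text \<open>Centrality over \<open>k\<close> holds since both actions are linear in \<open>A\<close> for the same
  \<open>k\<close>-module structure on \<open>V\<close>.\<close>

locale central_bimodule = right_module k A V r
  for k :: "('k, 'r) ring_scheme"
    and A :: "('k, 'a, 'x) module_scheme"
    and V :: "('k, 'v, 'y) module_scheme"
    and r :: "'v \<Rightarrow> 'a \<Rightarrow> 'v" +
  fixes l :: "'a \<Rightarrow> 'v \<Rightarrow> 'v"
  assumes left_linear: "a \<in> carrier A \<Longrightarrow> l a \<in> linear_maps k V V"
    and left_linear_scalar: "v \<in> carrier V \<Longrightarrow> (\<lambda>a. l a v) \<in> linear_maps k A V"
    and left_one: "v \<in> carrier V \<Longrightarrow> l \<one>\<^bsub>A\<^esub> v = v"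
    and left_mult: "\<lbrakk>v \<in> carrier V; a \<in> carrier A; b \<in> carrier A\<rbrakk>
      \<Longrightarrow> l (a \<otimes>\<^bsub>A\<^esub> b) v = l a (l b v)"
    and left_right: "\<lbrakk>v \<in> carrier V; a \<in> carrier A; b \<in> carrier A\<rbrakk>
      \<Longrightarrow> r (l a v) b = l a (r v b)"

text \<open>In \<open>coassociative\<close>, \<open>V \<otimes> A \<otimes> A\<close> is bracketed as \<open>(V \<otimes> A) \<otimes> A\<close>.\<close>

locale sweedler_comodule = right_module k A V r
  for k :: "('k, 'r) ring_scheme"
    and A :: "('k, 'a, 'x) module_scheme"
    and V :: "('k, 'v, 'y) module_scheme"
    and r :: "'v \<Rightarrow> 'a \<Rightarrow> 'v" +
  fixes \<rho> :: "'v \<Rightarrow> ('v \<times> 'a \<Rightarrow> 'k) set"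
  assumes coaction_linear: "\<rho> \<in> linear_maps k V (tensor k V A)"
    and counital: "v \<in> carrier V \<Longrightarrow> tensor_lift k V r (\<rho> v) = v"
    and coassociative: "v \<in> carrier V \<Longrightarrow>
      tensor_map k (tensor k V A) A \<rho> (\<lambda>b. b) (\<rho> v) =
      tensor_map k (tensor k V A) A (\<lambda>u. pure_tensor k V A u \<one>\<^bsub>A\<^esub>) (\<lambda>b. b) (\<rho> v)"
    and coaction_right: "\<lbrakk>v \<in> carrier V; a \<in> carrier A\<rbrakk> \<Longrightarrow>
      \<rho> (r v a) = tensor_map k V A (\<lambda>u. u) (\<lambda>b. b \<otimes>\<^bsub>A\<^esub> a) (\<rho> v)"

locale yetter_drinfeld_module =
  central_bimodule k A V r l + sweedler_comodule k A V r \<rho>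
  for k :: "('k, 'r) ring_scheme"
    and A :: "('k, 'a, 'x) module_scheme"
    and V :: "('k, 'v, 'y) module_scheme"
    and r :: "'v \<Rightarrow> 'a \<Rightarrow> 'v"
    and l :: "'a \<Rightarrow> 'v \<Rightarrow> 'v"
    and \<rho> :: "'v \<Rightarrow> ('v \<times> 'a \<Rightarrow> 'k) set" +
  assumes coaction_left: "\<lbrakk>v \<in> carrier V; a \<in> carrier A\<rbrakk> \<Longrightarrow>
      \<rho> (l a v) = tensor_map k V A (\<lambda>u. u) (\<lambda>b. a \<otimes>\<^bsub>A\<^esub> b) (\<rho> v)"
    and coaction_central: "\<lbrakk>v \<in> carrier V; a \<in> carrier A\<rbrakk> \<Longrightarrow>
      tensor_map k V A (\<lambda>u. l a u) (\<lambda>b. b) (\<rho> v) = tensor_map k V A (\<lambda>u. r u a) (\<lambda>b. b) (\<rho> v)"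

text \<open>\<open>w\<^sub>[\<^sub>0\<^sub>] \<otimes> w\<^sub>[\<^sub>1\<^sub>] v\<close> and the linear map it induces on \<open>V \<otimes> V\<close>.\<close>

definition yd_omega_pure where
  "yd_omega_pure k V l \<rho> v w = tensor_map k V V (\<lambda>u. u) (\<lambda>a. l a v) (\<rho> w)"

definition yd_omega where
  "yd_omega k V l \<rho> = tensor_lift k (tensor k V V) (yd_omega_pure k V l \<rho>)"

text \<open>\<open>w\<^sub>[\<^sub>0\<^sub>] \<otimes> v\<^sub>[\<^sub>0\<^sub>] w\<^sub>[\<^sub>1\<^sub>] v\<^sub>[\<^sub>1\<^sub>]\<close> and the linear map it induces on \<open>V \<otimes> V\<close>; the inner
  \<^const>\<open>tensor_lift\<close> is \<open>v\<^sub>[\<^sub>0\<^sub>] a v\<^sub>[\<^sub>1\<^sub>]\<close>.\<close>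

definition comodule_omega_pure where
  "comodule_omega_pure k V r \<rho> v w =
    tensor_map k V V (\<lambda>u. u) (\<lambda>a. tensor_lift k V (\<lambda>u b. r (r u a) b) (\<rho> v)) (\<rho> w)"

definition comodule_omega where
  "comodule_omega k V r \<rho> = tensor_lift k (tensor k V V) (comodule_omega_pure k V r \<rho>)"

end

theory Submission
  imports Defs
begin

text \<open>
  Write the Sweedler sum of \<open>F v\<^sub>[\<^sub>0\<^sub>] v\<^sub>[\<^sub>1\<^sub>]\<close> as \<open>tensor_lift k P F (\<rho> v)\<close>. Coassociativity turns
  \<open>w\<^sub>[\<^sub>0\<^sub>]\<^sub>[\<^sub>0\<^sub>] \<otimes> w\<^sub>[\<^sub>0\<^sub>]\<^sub>[\<^sub>1\<^sub>] \<otimes> w\<^sub>[\<^sub>1\<^sub>]\<close> into \<open>w\<^sub>[\<^sub>0\<^sub>] \<otimes> 1 \<otimes> w\<^sub>[\<^sub>1\<^sub>]\<close>, and with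
  \<open>\<rho>(av) = v\<^sub>[\<^sub>0\<^sub>] \<otimes> av\<^sub>[\<^sub>1\<^sub>]\<close> both sides of the Yang--Baxter equation send \<open>u \<otimes> v \<otimes> w\<close> to
  \<open>w\<^sub>[\<^sub>0\<^sub>] \<otimes> v\<^sub>[\<^sub>0\<^sub>] \<otimes> w\<^sub>[\<^sub>1\<^sub>]v\<^sub>[\<^sub>1\<^sub>]u\<close>. A comodule becomes a Yetter--Drinfeld module under
  \<open>a \<cdot> v = v\<^sub>[\<^sub>0\<^sub>]av\<^sub>[\<^sub>1\<^sub>]\<close>, and this action satisfies \<open>v\<^sub>[\<^sub>1\<^sub>] \<cdot> v\<^sub>[\<^sub>0\<^sub>] = v\<close>. Hence
  \<open>\<Omega>\<^sup>3(v \<otimes> w) = w\<^sub>[\<^sub>0\<^sub>] \<otimes> w\<^sub>[\<^sub>1\<^sub>]v\<^sub>[\<^sub>1\<^sub>]v\<^sub>[\<^sub>0\<^sub>] = w\<^sub>[\<^sub>0\<^sub>] \<otimes> w\<^sub>[\<^sub>1\<^sub>]v = \<Omega>(v \<otimes> w)\<close>.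
\<close>

section \<open>Linear and bilinear maps\<close>

lemma linear_mapsI:
  assumes "\<And>x. x \<in> carrier M \<Longrightarrow> f x \<in> carrier N"
    and "\<And>x y. \<lbrakk>x \<in> carrier M; y \<in> carrier M\<rbrakk> \<Longrightarrow> f (x \<oplus>\<^bsub>M\<^esub> y) = f x \<oplus>\<^bsub>N\<^esub> f y"
    and "\<And>c x. \<lbrakk>c \<in> carrier k; x \<in> carrier M\<rbrakk> \<Longrightarrow> f (c \<odot>\<^bsub>M\<^esub> x) = c \<odot>\<^bsub>N\<^esub> f x"
  shows "f \<in> linear_maps k M N"
  using assms by (auto simp: linear_maps_def)

lemma linear_maps_closed: "\<lbrakk>f \<in> linear_maps k M N; x \<in> carrier M\<rbrakk> \<Longrightarrow> f x \<in> carrier N"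
  by (auto simp: linear_maps_def)

lemma linear_maps_add:
  "\<lbrakk>f \<in> linear_maps k M N; x \<in> carrier M; y \<in> carrier M\<rbrakk> \<Longrightarrow> f (x \<oplus>\<^bsub>M\<^esub> y) = f x \<oplus>\<^bsub>N\<^esub> f y"
  by (auto simp: linear_maps_def)

lemma linear_maps_smult:
  "\<lbrakk>f \<in> linear_maps k M N; c \<in> carrier k; x \<in> carrier M\<rbrakk> \<Longrightarrow> f (c \<odot>\<^bsub>M\<^esub> x) = c \<odot>\<^bsub>N\<^esub> f x"
  by (auto simp: linear_maps_def)

text \<open>Linearity only concerns values on the carrier, while HOL functions are total. The module
  structure on \<open>M\<close> keeps sums and scalar multiples inside the carrier, so the two
  functions agree there too.\<close>

lemma linear_maps_cong:
  assumes "module k M" and "\<And>x. x \<in> carrier M \<Longrightarrow> f x = g x"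
  shows "f \<in> linear_maps k M N \<longleftrightarrow> g \<in> linear_maps k M N"
proof -
  interpret M: module k M by fact
  show ?thesis using assms(2) by (auto simp: linear_maps_def Pi_def)
qed

lemma linear_maps_id: "(\<lambda>x. x) \<in> linear_maps k M M"
  by (auto simp: linear_maps_def)

lemma linear_maps_comp:
  "\<lbrakk>f \<in> linear_maps k N P; g \<in> linear_maps k M N\<rbrakk> \<Longrightarrow> (\<lambda>x. f (g x)) \<in> linear_maps k M P"
  by (auto simp: linear_maps_def Pi_def)

lemma linear_maps_zero:
  assumes "module k M" "module k N" "f \<in> linear_maps k M N"
  shows "f \<zero>\<^bsub>M\<^esub> = \<zero>\<^bsub>N\<^esub>"
proof -
  interpret M: module k M by fact
  interpret N: module k N by fact
  have "f \<zero>\<^bsub>M\<^esub> = f (\<zero>\<^bsub>k\<^esub> \<odot>\<^bsub>M\<^esub> \<zero>\<^bsub>M\<^esub>)" by simp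
  also have "\<dots> = \<zero>\<^bsub>k\<^esub> \<odot>\<^bsub>N\<^esub> f \<zero>\<^bsub>M\<^esub>" using assms(3) by (intro linear_maps_smult) auto
  also have "\<dots> = \<zero>\<^bsub>N\<^esub>" using assms(3) by (simp add: linear_maps_closed)
  finally show ?thesis .
qed

lemma linear_maps_minus:
  assumes "module k M" "module k N" "f \<in> linear_maps k M N" "x \<in> carrier M" "y \<in> carrier M"
  shows "f (x \<ominus>\<^bsub>M\<^esub> y) = f x \<ominus>\<^bsub>N\<^esub> f y"
proof -
  interpret M: module k M by fact
  interpret N: module k N by fact
  note cl = linear_maps_closed[OF assms(3)]
  have "f (\<ominus>\<^bsub>M\<^esub> y) \<oplus>\<^bsub>N\<^esub> f y = f (\<ominus>\<^bsub>M\<^esub> y \<oplus>\<^bsub>M\<^esub> y)"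
    using assms by (simp add: linear_maps_add)
  also have "\<dots> = \<zero>\<^bsub>N\<^esub>" using assms by (simp add: M.l_neg linear_maps_zero)
  finally have "f (\<ominus>\<^bsub>M\<^esub> y) = \<ominus>\<^bsub>N\<^esub> f y"
    using assms by (intro N.minus_equality[symmetric]) (auto simp: cl)
  then show ?thesis
    using assms by (simp add: M.minus_eq N.minus_eq linear_maps_add[OF assms(3)])
qed

section \<open>Bilinear maps as maps linear in each variable on the carriers\<close>

definition bilinear_maps ::
    "('k, 'r) ring_scheme \<Rightarrow> ('k, 'm, 'x) module_scheme \<Rightarrow> ('k, 'n, 'y) module_scheme
      \<Rightarrow> ('k, 'p, 'z) module_scheme \<Rightarrow> ('m \<Rightarrow> 'n \<Rightarrow> 'p) set" where
  "bilinear_maps k M N P =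
    {f. (\<forall>m\<in>carrier M. f m \<in> linear_maps k N P) \<and>
        (\<forall>n\<in>carrier N. (\<lambda>m. f m n) \<in> linear_maps k M P)}"

lemma bilinear_mapsI:
  assumes "\<And>m. m \<in> carrier M \<Longrightarrow> (\<lambda>n. f m n) \<in> linear_maps k N P"
    and "\<And>n. n \<in> carrier N \<Longrightarrow> (\<lambda>m. f m n) \<in> linear_maps k M P"
  shows "f \<in> bilinear_maps k M N P"
  using assms by (auto simp: bilinear_maps_def)

lemma bilinear_maps_left:
  "\<lbrakk>f \<in> bilinear_maps k M N P; n \<in> carrier N\<rbrakk> \<Longrightarrow> (\<lambda>m. f m n) \<in> linear_maps k M P"
  by (auto simp: bilinear_maps_def)

lemma bilinear_maps_right:
  "\<lbrakk>f \<in> bilinear_maps k M N P; m \<in> carrier M\<rbrakk> \<Longrightarrow> f m \<in> linear_maps k N P"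
  by (auto simp: bilinear_maps_def)

lemma bilinear_maps_closed:
  "\<lbrakk>f \<in> bilinear_maps k M N P; m \<in> carrier M; n \<in> carrier N\<rbrakk> \<Longrightarrow> f m n \<in> carrier P"
  by (auto intro: linear_maps_closed bilinear_maps_right)

section \<open>Free modules\<close>

lemma basis_vector_closed:
  assumes "cring k" "b \<in> B"
  shows "basis_vector k b \<in> carrier (free_module k B)"
proof -
  interpret cring k by fact
  have "finite {c. basis_vector k b c \<noteq> \<zero>\<^bsub>k\<^esub>}"
    by (rule finite_subset[of _ "{b}"]) (auto simp: basis_vector_def)
  then show ?thesis using assms(2) by (auto simp: free_module_def basis_vector_def)
qed

lemma free_module_module:
  fixes k :: "('k, 'r) ring_scheme" and B :: "'b set"
  assumes "cring k"
  shows "module k (free_module k B)"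
proof -
  interpret cring k by fact
  have mem: "f b \<in> carrier k" if "f \<in> carrier (free_module k B)" for f b
    using that by (cases "b \<in> B") (auto simp: free_module_def)
  have fin_add: "finite {b. f b \<oplus>\<^bsub>k\<^esub> g b \<noteq> \<zero>\<^bsub>k\<^esub>}"
    if "finite {b. f b \<noteq> \<zero>\<^bsub>k\<^esub>}" "finite {b. g b \<noteq> \<zero>\<^bsub>k\<^esub>}" for f g :: "'b \<Rightarrow> 'k"
    by (rule finite_subset[OF _ finite_UnI[OF that]]) auto
  have fin_smult: "finite {b. c \<otimes>\<^bsub>k\<^esub> f b \<noteq> \<zero>\<^bsub>k\<^esub>}"
    if "finite {b. f b \<noteq> \<zero>\<^bsub>k\<^esub>}" "c \<in> carrier k" for c and f :: "'b \<Rightarrow> 'k"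
    by (rule finite_subset[OF _ that(1)]) (use that(2) in auto)
  have add_cl: "f \<oplus>\<^bsub>free_module k B\<^esub> g \<in> carrier (free_module k B)"
    if "f \<in> carrier (free_module k B)" "g \<in> carrier (free_module k B)" for f g
    using that by (auto simp: free_module_def intro!: fin_add)
  have smult_cl: "c \<odot>\<^bsub>free_module k B\<^esub> f \<in> carrier (free_module k B)"
    if "c \<in> carrier k" "f \<in> carrier (free_module k B)" for c f
    using that by (auto simp: free_module_def intro!: fin_smult)
  show ?thesis
  proof (rule moduleI)
    show "abelian_group (free_module k B)"
    proof (rule abelian_groupI)
      fix f assume f: "f \<in> carrier (free_module k B)"
      \<comment> \<open>The additive inverse is taken to be -1 times \<open>f\<close>, so that
        closure under scalar multiples also gives its finite support.\<close>
      have "\<ominus>\<^bsub>k\<^esub> \<one>\<^bsub>k\<^esub> \<odot>\<^bsub>free_module k B\<^esub> f \<oplus>\<^bsub>free_module k B\<^esub> f = \<zero>\<^bsub>free_module k B\<^esub>"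
        by (simp add: free_module_def fun_eq_iff mem[OF f] l_minus l_neg)
      then show "\<exists>g\<in>carrier (free_module k B). g \<oplus>\<^bsub>free_module k B\<^esub> f = \<zero>\<^bsub>free_module k B\<^esub>"
        using smult_cl[OF _ f] by blast
    next
      fix f g h assume "f \<in> carrier (free_module k B)" "g \<in> carrier (free_module k B)"
        "h \<in> carrier (free_module k B)"
      note m = this[THEN mem]
      show "f \<oplus>\<^bsub>free_module k B\<^esub> g \<oplus>\<^bsub>free_module k B\<^esub> h =
          f \<oplus>\<^bsub>free_module k B\<^esub> (g \<oplus>\<^bsub>free_module k B\<^esub> h)"
        using m by (simp add: free_module_def a_assoc)
    next
      fix f g assume "f \<in> carrier (free_module k B)" "g \<in> carrier (free_module k B)"
      note m = this[THEN mem]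
      show "f \<oplus>\<^bsub>free_module k B\<^esub> g = g \<oplus>\<^bsub>free_module k B\<^esub> f"
        using m by (simp add: free_module_def a_comm)
    next
      fix f assume "f \<in> carrier (free_module k B)"
      note m = this[THEN mem]
      show "\<zero>\<^bsub>free_module k B\<^esub> \<oplus>\<^bsub>free_module k B\<^esub> f = f"
        using m by (simp add: free_module_def)
    next
      show "\<zero>\<^bsub>free_module k B\<^esub> \<in> carrier (free_module k B)" by (simp add: free_module_def)
    qed (rule add_cl)
  next
    fix c d and f assume c: "c \<in> carrier k" and d: "d \<in> carrier k" and "f \<in> carrier (free_module k B)"
    note m = this(3)[THEN mem]
    show "(c \<oplus>\<^bsub>k\<^esub> d) \<odot>\<^bsub>free_module k B\<^esub> f =
        c \<odot>\<^bsub>free_module k B\<^esub> f \<oplus>\<^bsub>free_module k B\<^esub> d \<odot>\<^bsub>free_module k B\<^esub> f"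
      using m c d by (simp add: free_module_def l_distr)
    show "(c \<otimes>\<^bsub>k\<^esub> d) \<odot>\<^bsub>free_module k B\<^esub> f = c \<odot>\<^bsub>free_module k B\<^esub> (d \<odot>\<^bsub>free_module k B\<^esub> f)"
      using m c d by (simp add: free_module_def m_assoc)
  next
    fix c f g assume c: "c \<in> carrier k" and "f \<in> carrier (free_module k B)" "g \<in> carrier (free_module k B)"
    note m = this(2,3)[THEN mem]
    show "c \<odot>\<^bsub>free_module k B\<^esub> (f \<oplus>\<^bsub>free_module k B\<^esub> g) =
        c \<odot>\<^bsub>free_module k B\<^esub> f \<oplus>\<^bsub>free_module k B\<^esub> c \<odot>\<^bsub>free_module k B\<^esub> g"
      using m c by (simp add: free_module_def r_distr)
  next
    fix f assume "f \<in> carrier (free_module k B)"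
    note m = this[THEN mem]
    show "\<one>\<^bsub>k\<^esub> \<odot>\<^bsub>free_module k B\<^esub> f = f"
      using m by (simp add: free_module_def)
  qed (use assms smult_cl in auto)
qed

text \<open>A function of finite support is built up one basis vector at a time. The induction runs
  over a finite set \<open>S\<close> that merely contains the support, so a coefficient that already
  vanishes costs nothing.\<close>

lemma free_module_induct [consumes 2, case_names zero add]:
  assumes "cring k" and x: "x \<in> carrier (free_module k B)"
    and zero: "P \<zero>\<^bsub>free_module k B\<^esub>"
    and add: "\<And>c b y. \<lbrakk>c \<in> carrier k; b \<in> B; y \<in> carrier (free_module k B); P y\<rbrakk> \<Longrightarrow>
      P (c \<odot>\<^bsub>free_module k B\<^esub> basis_vector k b \<oplus>\<^bsub>free_module k B\<^esub> y)"
  shows "P x"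
proof -
  interpret cring k by fact
  have "P x" if "finite S" "x \<in> carrier (free_module k B)" "{b. x b \<noteq> \<zero>\<^bsub>k\<^esub>} \<subseteq> S" for S x
    using that
  proof (induction S arbitrary: x)
    case empty
    then have "x = \<zero>\<^bsub>free_module k B\<^esub>" by (auto simp: free_module_def)
    then show ?case using zero by simp
  next
    case (insert b S)
    show ?case
    proof (cases "x b = \<zero>\<^bsub>k\<^esub>")
      case True
      then show ?thesis using insert by (intro insert.IH) auto
    next
      case False
      \<comment> \<open>Erasing the coefficient at \<open>b\<close> leaves a function supported in
        \<open>S\<close>, to which the induction hypothesis applies.\<close>
      define y where "y = x(b := \<zero>\<^bsub>k\<^esub>)"
      have b: "b \<in> B" and xb: "x b \<in> carrier k"
        using False insert.prems(1) by (auto simp: free_module_def)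
      have "finite {c. y c \<noteq> \<zero>\<^bsub>k\<^esub>}"
        by (rule finite_subset[OF _ insert.hyps(1)]) (use insert.prems(2) in \<open>auto simp: y_def\<close>)
      then have y: "y \<in> carrier (free_module k B)"
        using insert.prems(1) by (auto simp: y_def free_module_def)
      have "x c \<in> carrier k" for c
        using insert.prems(1) by (cases "c \<in> B") (auto simp: free_module_def)
      then have "x = x b \<odot>\<^bsub>free_module k B\<^esub> basis_vector k b \<oplus>\<^bsub>free_module k B\<^esub> y"
        by (auto simp: fun_eq_iff y_def free_module_def basis_vector_def)
      moreover have "P y"
        using insert.prems(2) by (intro insert.IH y) (auto simp: y_def)
      ultimately show ?thesis using add[OF xb b y] by simp
    qed
  qed
  then show ?thesis using x by (auto simp: free_module_def)
qed

text \<open>The sum over the exact support has the shape used in \<open>tensor_lift\<close>; hence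
  \<open>tensor_lift\<close> is by unfolding the value of \<open>free_lift\<close> on the chosen
  representative.\<close>

definition free_lift ::
    "('k, 'r) ring_scheme \<Rightarrow> ('k, 'p, 'x) module_scheme \<Rightarrow> ('b \<Rightarrow> 'p) \<Rightarrow> ('b \<Rightarrow> 'k) \<Rightarrow> 'p" where
  "free_lift k P f x = finsum P (\<lambda>b. x b \<odot>\<^bsub>P\<^esub> f b) {b. x b \<noteq> \<zero>\<^bsub>k\<^esub>}"

lemma free_lift_linear:
  assumes "module k P" and f: "f \<in> B \<rightarrow> carrier P"
  shows "free_lift k P f \<in> linear_maps k (free_module k B) P"
proof -
  interpret P: module k P by fact
  have mem: "x b \<odot>\<^bsub>P\<^esub> f b \<in> carrier P" if "x \<in> carrier (free_module k B)" "b \<in> B" for x b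
    using that f by (auto simp: free_module_def)
  \<comment> \<open>Supports of sums and multiples may shrink by cancellation. Padding with zero
    terms lets all sums run over one common finite set, where they can be compared termwise.\<close>
  have supp: "free_lift k P f x = finsum P (\<lambda>b. x b \<odot>\<^bsub>P\<^esub> f b) S"
    if "x \<in> carrier (free_module k B)" "{b. x b \<noteq> \<zero>\<^bsub>k\<^esub>} \<subseteq> S" "S \<subseteq> B" "finite S" for x S
    unfolding free_lift_def
  proof (rule P.add.finprod_mono_neutral_cong_left)
    show "x b \<odot>\<^bsub>P\<^esub> f b = \<zero>\<^bsub>P\<^esub>" if "b \<in> S - {b. x b \<noteq> \<zero>\<^bsub>k\<^esub>}" for b
      using that \<open>S \<subseteq> B\<close> f by (auto simp: Pi_def)
  qed (use that mem in auto)
  have suppB: "{b. x b \<noteq> \<zero>\<^bsub>k\<^esub>} \<subseteq> B" and suppF: "finite {b. x b \<noteq> \<zero>\<^bsub>k\<^esub>}"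
    if "x \<in> carrier (free_module k B)" for x
    using that by (auto simp: free_module_def)
  have xk: "x b \<in> carrier k" if "x \<in> carrier (free_module k B)" for x b
    using that by (cases "b \<in> B") (auto simp: free_module_def)
  interpret F: module k "free_module k B" by (rule free_module_module) (rule P.is_cring)
  show ?thesis
  proof (rule linear_mapsI)
    fix x assume x: "x \<in> carrier (free_module k B)"
    show "free_lift k P f x \<in> carrier P"
      unfolding free_lift_def using mem[OF x] suppB[OF x] by (intro P.finsum_closed) auto
    fix c assume c: "c \<in> carrier k"
    let ?S = "{b. x b \<noteq> \<zero>\<^bsub>k\<^esub>}"
    have "free_lift k P f (c \<odot>\<^bsub>free_module k B\<^esub> x) =
        finsum P (\<lambda>b. (c \<odot>\<^bsub>free_module k B\<^esub> x) b \<odot>\<^bsub>P\<^esub> f b) ?S"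
    proof (rule supp)
      show "{b. (c \<odot>\<^bsub>free_module k B\<^esub> x) b \<noteq> \<zero>\<^bsub>k\<^esub>} \<subseteq> ?S"
        using c by (auto simp: free_module_def)
    qed (use c x suppB suppF in auto)
    also have "\<dots> = finsum P (\<lambda>b. c \<odot>\<^bsub>P\<^esub> (x b \<odot>\<^bsub>P\<^esub> f b)) ?S"
    proof (rule P.finsum_cong')
      fix b assume "b \<in> ?S"
      then show "(c \<odot>\<^bsub>free_module k B\<^esub> x) b \<odot>\<^bsub>P\<^esub> f b = c \<odot>\<^bsub>P\<^esub> (x b \<odot>\<^bsub>P\<^esub> f b)"
        using c xk[OF x] suppB[OF x] f
        by (auto simp: free_module_def Pi_def intro!: P.smult_assoc1)
    qed (use c mem[OF x] suppB[OF x] in auto)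
    also have "\<dots> = c \<odot>\<^bsub>P\<^esub> free_lift k P f x"
      unfolding free_lift_def using c mem[OF x] suppB[OF x] suppF[OF x]
      by (intro P.finsum_smult_ldistr[symmetric]) auto
    finally show "free_lift k P f (c \<odot>\<^bsub>free_module k B\<^esub> x) = c \<odot>\<^bsub>P\<^esub> free_lift k P f x" .
  next
    fix x y assume x: "x \<in> carrier (free_module k B)" and y: "y \<in> carrier (free_module k B)"
    let ?S = "{b. x b \<noteq> \<zero>\<^bsub>k\<^esub>} \<union> {b. y b \<noteq> \<zero>\<^bsub>k\<^esub>}"
    have SB: "?S \<subseteq> B" and Sf: "finite ?S" using suppB[OF x] suppB[OF y] suppF[OF x] suppF[OF y] by auto
    have "free_lift k P f (x \<oplus>\<^bsub>free_module k B\<^esub> y) =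
        finsum P (\<lambda>b. (x \<oplus>\<^bsub>free_module k B\<^esub> y) b \<odot>\<^bsub>P\<^esub> f b) ?S"
    proof (rule supp)
      show "{b. (x \<oplus>\<^bsub>free_module k B\<^esub> y) b \<noteq> \<zero>\<^bsub>k\<^esub>} \<subseteq> ?S"
        by (auto simp: free_module_def)
    qed (use SB Sf x y in auto)
    also have "\<dots> = finsum P (\<lambda>b. x b \<odot>\<^bsub>P\<^esub> f b \<oplus>\<^bsub>P\<^esub> y b \<odot>\<^bsub>P\<^esub> f b) ?S"
    proof (rule P.finsum_cong')
      fix b assume "b \<in> ?S"
      then have "b \<in> B" using SB by auto
      then show "(x \<oplus>\<^bsub>free_module k B\<^esub> y) b \<odot>\<^bsub>P\<^esub> f b = x b \<odot>\<^bsub>P\<^esub> f b \<oplus>\<^bsub>P\<^esub> y b \<odot>\<^bsub>P\<^esub> f b"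
        using xk[OF x] xk[OF y] f
        by (auto simp: free_module_def Pi_def intro!: P.smult_l_distr)
    qed (use mem x y SB in auto)
    also have "\<dots> = finsum P (\<lambda>b. x b \<odot>\<^bsub>P\<^esub> f b) ?S \<oplus>\<^bsub>P\<^esub> finsum P (\<lambda>b. y b \<odot>\<^bsub>P\<^esub> f b) ?S"
      using mem x y SB by (intro P.finsum_addf) auto
    also have "\<dots> = free_lift k P f x \<oplus>\<^bsub>P\<^esub> free_lift k P f y"
      using x y SB Sf by (simp add: supp[of x ?S] supp[of y ?S])
    finally show "free_lift k P f (x \<oplus>\<^bsub>free_module k B\<^esub> y) = free_lift k P f x \<oplus>\<^bsub>P\<^esub> free_lift k P f y" .
  qed
qed

lemma free_lift_basis_vector:
  assumes "module k P" and b: "f b \<in> carrier P"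
  shows "free_lift k P f (basis_vector k b) = f b"
proof -
  interpret P: module k P by fact
  \<comment> \<open>If \<one> = \<zero> in \<open>k\<close>, the basis vector has empty support and
    the sum is zero; in that case every element of \<open>P\<close> is zero as well.\<close>
  have triv: "f b = \<zero>\<^bsub>P\<^esub>" if "\<one>\<^bsub>k\<^esub> = \<zero>\<^bsub>k\<^esub>"
    using that P.smult_one[OF b] P.smult_l_null[OF b] by metis
  have "free_lift k P f (basis_vector k b) = finsum P (\<lambda>c. basis_vector k b c \<odot>\<^bsub>P\<^esub> f c) {b}"
    unfolding free_lift_def
    by (rule P.add.finprod_mono_neutral_cong_left)
      (use b triv in \<open>auto simp: basis_vector_def\<close>)
  then show ?thesis using b by (simp add: P.finsum_insert basis_vector_def)
qed

section \<open>Quotient modules\<close>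

context
  fixes k :: "('k, 'r) ring_scheme" and M :: "('k, 'm, 'x) module_scheme" and H :: "'m set"
  assumes M: "module k M" and H: "submodule H k M"
begin

lemma submodule_abelian_subgroup: "abelian_subgroup H M"
proof -
  interpret module k M by (rule M)
  show ?thesis
    using submodule.axioms(1)[OF H] by (intro abelian_subgroupI3 additive_subgroupI) (auto intro: M.abelian_group_axioms)
qed

lemma quotient_module_add:
  assumes "x \<in> carrier M" "y \<in> carrier M"
  shows "(H +>\<^bsub>M\<^esub> x) \<oplus>\<^bsub>quotient_module M H\<^esub> (H +>\<^bsub>M\<^esub> y) = H +>\<^bsub>M\<^esub> (x \<oplus>\<^bsub>M\<^esub> y)"
proof -
  interpret abelian_subgroup H M by (rule submodule_abelian_subgroup)
  show ?thesis using assms by (simp add: quotient_module_def a_rcos_sum)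
qed

text \<open>The scalar multiple is encoded as a union of the cosets of c y over all y in the given
  coset. These cosets all coincide because c h stays in \<open>H\<close>, so the union is the single
  coset of c x.\<close>

lemma quotient_module_smult:
  assumes c: "c \<in> carrier k" and x: "x \<in> carrier M"
  shows "c \<odot>\<^bsub>quotient_module M H\<^esub> (H +>\<^bsub>M\<^esub> x) = H +>\<^bsub>M\<^esub> (c \<odot>\<^bsub>M\<^esub> x)"
proof -
  interpret S: abelian_subgroup H M by (rule submodule_abelian_subgroup)
  interpret M: module k M by (rule M)
  have "H +>\<^bsub>M\<^esub> (c \<odot>\<^bsub>M\<^esub> y) = H +>\<^bsub>M\<^esub> (c \<odot>\<^bsub>M\<^esub> x)" if y: "y \<in> H +>\<^bsub>M\<^esub> x" for y
  proof -
    obtain h where h: "h \<in> H" "y = h \<oplus>\<^bsub>M\<^esub> x" using y by (auto simp: a_r_coset_def')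
    have ch: "c \<odot>\<^bsub>M\<^esub> h \<in> H" using submodule.smult_closed[OF H c h(1)] .
    have "c \<odot>\<^bsub>M\<^esub> y = c \<odot>\<^bsub>M\<^esub> h \<oplus>\<^bsub>M\<^esub> c \<odot>\<^bsub>M\<^esub> x"
      using h c x by (simp add: M.smult_r_distr)
    then have "c \<odot>\<^bsub>M\<^esub> y \<in> H +>\<^bsub>M\<^esub> (c \<odot>\<^bsub>M\<^esub> x)" using ch by (auto simp: a_r_coset_def')
    then show ?thesis using c x by (intro S.a_repr_independence'[symmetric]) auto
  qed
  moreover have "x \<in> H +>\<^bsub>M\<^esub> x" using x by (rule S.a_rcos_self)
  ultimately have "(\<Union>y\<in>H +>\<^bsub>M\<^esub> x. H +>\<^bsub>M\<^esub> (c \<odot>\<^bsub>M\<^esub> y)) = H +>\<^bsub>M\<^esub> (c \<odot>\<^bsub>M\<^esub> x)" by blast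
  then show ?thesis by (simp add: quotient_module_def)
qed

lemma quotient_module_carrier: "carrier (quotient_module M H) = (\<lambda>x. H +>\<^bsub>M\<^esub> x) ` carrier M"
  by (auto simp: quotient_module_def A_RCOSETS_def')

lemma quotient_module_zero: "\<zero>\<^bsub>quotient_module M H\<^esub> = H +>\<^bsub>M\<^esub> \<zero>\<^bsub>M\<^esub>"
proof -
  interpret S: abelian_subgroup H M by (rule submodule_abelian_subgroup)
  show ?thesis using S.a_subset by (simp add: quotient_module_def S.a_coset_add_zero)
qed

lemma quotient_module_module: "module k (quotient_module M H)"
proof -
  interpret M: module k M by (rule M)
  note simps = quotient_module_carrier quotient_module_add quotient_module_smult quotient_module_zero
  show ?thesis
  proof (rule moduleI)
    show "abelian_group (quotient_module M H)"
    proof (rule abelian_groupI)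
      fix X assume "X \<in> carrier (quotient_module M H)"
      then obtain x where x: "x \<in> carrier M" "X = H +>\<^bsub>M\<^esub> x" by (auto simp: simps)
      show "\<exists>Y\<in>carrier (quotient_module M H). Y \<oplus>\<^bsub>quotient_module M H\<^esub> X = \<zero>\<^bsub>quotient_module M H\<^esub>"
        using x by (intro bexI[of _ "H +>\<^bsub>M\<^esub> (\<ominus>\<^bsub>M\<^esub> x)"]) (auto simp: simps M.l_neg)
    qed (auto simp: simps M.a_assoc M.a_comm M.a_lcomm)
  qed (auto simp: simps M.smult_l_distr M.smult_r_distr M.smult_assoc1 M.is_cring)
qed

lemma quotient_module_projection: "(\<lambda>x. H +>\<^bsub>M\<^esub> x) \<in> linear_maps k M (quotient_module M H)"
  by (rule linear_mapsI) (auto simp: quotient_module_carrier quotient_module_add quotient_module_smult)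

lemma quotient_module_eq_zero:
  assumes "x \<in> H" shows "H +>\<^bsub>M\<^esub> x = \<zero>\<^bsub>quotient_module M H\<^esub>"
proof -
  interpret S: abelian_subgroup H M by (rule submodule_abelian_subgroup)
  show ?thesis using assms by (simp add: S.a_rcos_const quotient_module_def)
qed

end

section \<open>Tensor products\<close>

text \<open>This makes the \<open>hull\<close> in \<open>bilinear_submodule\<close> an actual
  submodule. The family must be nonempty, since an empty intersection would be the whole
  type.\<close>

lemma submodule_Inter:
  fixes k :: "('k, 'r) ring_scheme" and M :: "('k, 'm, 'x) module_scheme"
  assumes "module k M" "\<And>H. H \<in> S \<Longrightarrow> submodule H k M" "S \<noteq> {}"
  shows "submodule (\<Inter>S) k M"
proof -
  interpret module k M by fact
  note E = submoduleE[OF assms(2)]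
  have zero: "\<zero>\<^bsub>M\<^esub> \<in> H" if "H \<in> S" for H
    using subgroup.one_closed[OF submodule.axioms(1)[OF assms(2)[OF that]]] by simp
  show ?thesis
  proof (rule submoduleI)
    show "\<Inter>S \<subseteq> carrier M" using E(1) assms(3) by blast
    show "\<ominus>\<^bsub>M\<^esub> a \<in> \<Inter>S" if "a \<in> \<Inter>S" for a
      using that by (intro InterI E(3)) auto
    show "a \<oplus>\<^bsub>M\<^esub> b \<in> \<Inter>S" if "a \<in> \<Inter>S" "b \<in> \<Inter>S" for a b
      using that by (intro InterI E(5)) auto
    show "c \<odot>\<^bsub>M\<^esub> a \<in> \<Inter>S" if "c \<in> carrier k" "a \<in> \<Inter>S" for c a
      using that by (intro InterI E(4)) auto
  qed (use zero in auto)
qed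

section \<open>Pure tensors: bilinearity, generation and equality of linear maps\<close>

context
  fixes k :: "('k, 'r) ring_scheme"
    and M :: "('k, 'm, 'x) module_scheme"
    and N :: "('k, 'n, 'y) module_scheme"
  assumes M: "module k M" and N: "module k N"
begin

interpretation M: module k M by (rule M)
interpretation N: module k N by (rule N)
interpretation F: module k "tensor_free k M N"
  unfolding tensor_free_def by (rule free_module_module) (rule M.R.is_cring)

private abbreviation e where "e m n \<equiv> basis_vector k (m, n)"

private lemma basis: "\<lbrakk>m \<in> carrier M; n \<in> carrier N\<rbrakk> \<Longrightarrow> e m n \<in> carrier (tensor_free k M N)"
  unfolding tensor_free_def by (intro basis_vector_closed M.R.is_cring) auto

private lemma relators_carrier: "bilinear_relators k M N \<subseteq> carrier (tensor_free k M N)"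
  unfolding bilinear_relators_def Let_def
  by (auto intro!: F.minus_closed F.a_closed F.smult_closed basis)

text \<open>The family whose intersection is the hull is nonempty: the whole free module is a
  submodule containing the relators.\<close>

private lemma submodule: "submodule (bilinear_submodule k M N) k (tensor_free k M N)"
  unfolding bilinear_submodule_def hull_def
  using F.carrier_is_submodule relators_carrier by (intro submodule_Inter F.module_axioms) auto

private lemma relators_subset: "bilinear_relators k M N \<subseteq> bilinear_submodule k M N"
  unfolding bilinear_submodule_def by (rule hull_subset)

lemma tensor_module: "module k (tensor k M N)"
  unfolding tensor_def by (rule quotient_module_module[OF F.module_axioms submodule])

private abbreviation pr where "pr x \<equiv> bilinear_submodule k M N +>\<^bsub>tensor_free k M N\<^esub> x"

private lemma pr_linear: "pr \<in> linear_maps k (tensor_free k M N) (tensor k M N)"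
  unfolding tensor_def by (rule quotient_module_projection[OF F.module_axioms submodule])

private lemma pr_surj: "carrier (tensor k M N) = pr ` carrier (tensor_free k M N)"
  unfolding tensor_def by (rule quotient_module_carrier[OF F.module_axioms submodule])

text \<open>A relator is killed by the projection, so the images have difference zero; uniqueness of
  additive inverses then identifies them.\<close>

private lemma pr_eq:
  assumes "x \<ominus>\<^bsub>tensor_free k M N\<^esub> y \<in> bilinear_relators k M N"
    "x \<in> carrier (tensor_free k M N)" "y \<in> carrier (tensor_free k M N)"
  shows "pr x = pr y"
proof -
  interpret T: module k "tensor k M N" by (rule tensor_module)
  have "pr x \<ominus>\<^bsub>tensor k M N\<^esub> pr y = pr (x \<ominus>\<^bsub>tensor_free k M N\<^esub> y)"
    using assms(2,3) by (rule linear_maps_minus[OF F.module_axioms tensor_module pr_linear, symmetric])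
  also have "\<dots> = \<zero>\<^bsub>tensor k M N\<^esub>"
    using assms(1) relators_subset
    unfolding tensor_def by (intro quotient_module_eq_zero[OF F.module_axioms submodule]) auto
  finally have "\<ominus>\<^bsub>tensor k M N\<^esub> (\<ominus>\<^bsub>tensor k M N\<^esub> pr y) = pr x"
    using assms(2,3) by (intro T.minus_equality) (auto simp: T.minus_eq linear_maps_closed[OF pr_linear])
  then show ?thesis using assms(3) by (simp add: linear_maps_closed[OF pr_linear])
qed

text \<open>Each of the four laws is the vanishing of one of the four families of relators in the
  quotient.\<close>

lemma pure_tensor_bilinear: "pure_tensor k M N \<in> bilinear_maps k M N (tensor k M N)"
proof (intro bilinear_mapsI linear_mapsI; unfold pure_tensor_def)
  note lin = linear_maps_add[OF pr_linear, symmetric] linear_maps_smult[OF pr_linear, symmetric]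
  fix m n assume m: "m \<in> carrier M" and n: "n \<in> carrier N"
  \<comment> \<open>The closure goal occurs twice, once for linearity in each variable.\<close>
  show "pr (e m n) \<in> carrier (tensor k M N)" "pr (e m n) \<in> carrier (tensor k M N)"
    using m n by (auto intro: linear_maps_closed[OF pr_linear] basis)
  { fix m' assume m': "m' \<in> carrier M"
    show "pr (e (m \<oplus>\<^bsub>M\<^esub> m') n) = pr (e m n) \<oplus>\<^bsub>tensor k M N\<^esub> pr (e m' n)"
      using m m' n by (simp add: lin basis, intro pr_eq)
        (auto simp: bilinear_relators_def Let_def intro: basis) }
  { fix n' assume n': "n' \<in> carrier N"
    show "pr (e m (n \<oplus>\<^bsub>N\<^esub> n')) = pr (e m n) \<oplus>\<^bsub>tensor k M N\<^esub> pr (e m n')"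
      using m n n' by (simp add: lin basis, intro pr_eq)
        (auto simp: bilinear_relators_def Let_def intro: basis) }
  fix c assume c: "c \<in> carrier k"
  show "pr (e (c \<odot>\<^bsub>M\<^esub> m) n) = c \<odot>\<^bsub>tensor k M N\<^esub> pr (e m n)"
    using m n c by (simp add: lin basis, intro pr_eq)
      (auto simp: bilinear_relators_def Let_def intro: basis)
  show "pr (e m (c \<odot>\<^bsub>N\<^esub> n)) = c \<odot>\<^bsub>tensor k M N\<^esub> pr (e m n)"
    using m n c by (simp add: lin basis, intro pr_eq)
      (auto simp: bilinear_relators_def Let_def intro: basis)
qed

lemma pure_tensor_closed:
  "\<lbrakk>m \<in> carrier M; n \<in> carrier N\<rbrakk> \<Longrightarrow> pure_tensor k M N m n \<in> carrier (tensor k M N)"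
  by (rule bilinear_maps_closed[OF pure_tensor_bilinear])

text \<open>Pure tensors generate: a representative in the free module is decomposed into basis
  vectors, and the linear projection carries this decomposition to the quotient.\<close>

lemma tensor_induct [consumes 1, case_names zero add]:
  assumes X: "X \<in> carrier (tensor k M N)"
    and zero: "P \<zero>\<^bsub>tensor k M N\<^esub>"
    and add: "\<And>c m n Y. \<lbrakk>c \<in> carrier k; m \<in> carrier M; n \<in> carrier N; Y \<in> carrier (tensor k M N); P Y\<rbrakk>
      \<Longrightarrow> P (c \<odot>\<^bsub>tensor k M N\<^esub> pure_tensor k M N m n \<oplus>\<^bsub>tensor k M N\<^esub> Y)"
  shows "P X"
proof -
  obtain x where x: "x \<in> carrier (tensor_free k M N)" "X = pr x" using X by (auto simp: pr_surj)
  have "P (pr x)" using M.R.is_cring x(1) unfolding tensor_free_def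
  proof (induction x rule: free_module_induct)
    case zero
    then show ?case
      using linear_maps_zero[OF F.module_axioms tensor_module pr_linear] assms(2)
      by (simp add: tensor_free_def)
  next
    case (add c b y)
    obtain m n where b: "b = (m, n)" "m \<in> carrier M" "n \<in> carrier N" using add(2) by auto
    have y: "y \<in> carrier (tensor_free k M N)" using add by (simp add: tensor_free_def)
    have "pr (c \<odot>\<^bsub>tensor_free k M N\<^esub> e m n \<oplus>\<^bsub>tensor_free k M N\<^esub> y) =
        c \<odot>\<^bsub>tensor k M N\<^esub> pure_tensor k M N m n \<oplus>\<^bsub>tensor k M N\<^esub> pr y"
      using b y add(1) by (simp add: linear_maps_add[OF pr_linear] linear_maps_smult[OF pr_linear] basis
          pure_tensor_def)
    moreover have "P (c \<odot>\<^bsub>tensor k M N\<^esub> pure_tensor k M N m n \<oplus>\<^bsub>tensor k M N\<^esub> pr y)"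
      using add b y by (intro assms(3) linear_maps_closed[OF pr_linear]) (auto simp: tensor_free_def)
    ultimately show ?case using b by (simp add: tensor_free_def)
  qed
  then show ?thesis using x by simp
qed

text \<open>The uniqueness half of the universal property, by induction along pure tensors. It
  reduces later identities of linear maps to a check on generators.\<close>

lemma tensor_ext:
  assumes "module k P" "f \<in> linear_maps k (tensor k M N) P" "g \<in> linear_maps k (tensor k M N) P"
    and "\<And>m n. \<lbrakk>m \<in> carrier M; n \<in> carrier N\<rbrakk> \<Longrightarrow> f (pure_tensor k M N m n) = g (pure_tensor k M N m n)"
    and X: "X \<in> carrier (tensor k M N)"
  shows "f X = g X"
proof -
  interpret T: module k "tensor k M N" by (rule tensor_module)
  show ?thesis using X
  proof (induction X rule: tensor_induct)
    case zero
    then show ?case by (simp add: linear_maps_zero[OF tensor_module assms(1)] assms(2,3))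
  next
    case (add c m n Y)
    then show ?case
      by (simp add: pure_tensor_closed linear_maps_add[OF assms(2)] linear_maps_add[OF assms(3)]
          linear_maps_smult[OF assms(2)] linear_maps_smult[OF assms(3)] assms(4))
  qed
qed

section \<open>The existence half of the universal property: lifting a bilinear map\<close>

context
  fixes P :: "('k, 'p, 'z) module_scheme" and f :: "'m \<Rightarrow> 'n \<Rightarrow> 'p"
  assumes P: "module k P" and f: "f \<in> bilinear_maps k M N P"
begin

interpretation P: module k P by (rule P)

private abbreviation fl where "fl \<equiv> free_lift k P (\<lambda>b. f (fst b) (snd b))"

private lemma fl_linear: "fl \<in> linear_maps k (tensor_free k M N) P"
  unfolding tensor_free_def
  by (rule free_lift_linear[OF P]) (auto intro: bilinear_maps_closed[OF f])

private lemma fl_basis: "\<lbrakk>m \<in> carrier M; n \<in> carrier N\<rbrakk> \<Longrightarrow> fl (e m n) = f m n"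
  by (simp add: free_lift_basis_vector[OF P] bilinear_maps_closed[OF f])

text \<open>The kernel of the free lift is a submodule, and bilinearity of \<open>f\<close> puts
  every relator in it. The hull, being the least such submodule, is contained in the kernel.\<close>

private lemma fl_relators:
  assumes "x \<in> bilinear_submodule k M N"
  shows "fl x = \<zero>\<^bsub>P\<^esub>"
proof -
  let ?K = "{x \<in> carrier (tensor_free k M N). fl x = \<zero>\<^bsub>P\<^esub>}"
  note minus = linear_maps_minus[OF F.module_axioms P fl_linear]
    and add = linear_maps_add[OF fl_linear] and smult = linear_maps_smult[OF fl_linear]
  have fzero: "fl \<zero>\<^bsub>tensor_free k M N\<^esub> = \<zero>\<^bsub>P\<^esub>" by (rule linear_maps_zero[OF F.module_axioms P fl_linear])
  have "submodule ?K k (tensor_free k M N)"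
  proof (rule F.submoduleI)
    fix a assume a: "a \<in> ?K"
    then have "fl (\<zero>\<^bsub>tensor_free k M N\<^esub> \<ominus>\<^bsub>tensor_free k M N\<^esub> a) = \<zero>\<^bsub>P\<^esub>"
      by (subst minus) (auto simp: fzero P.minus_eq)
    then show "\<ominus>\<^bsub>tensor_free k M N\<^esub> a \<in> ?K" using a by (simp add: F.minus_eq)
  qed (auto simp: fzero add smult)
  moreover have "bilinear_relators k M N \<subseteq> ?K"
  proof -
    note lf = linear_maps_add[OF bilinear_maps_left[OF f]] linear_maps_add[OF bilinear_maps_right[OF f]]
      linear_maps_smult[OF bilinear_maps_left[OF f]] linear_maps_smult[OF bilinear_maps_right[OF f]]
    have "fl x = \<zero>\<^bsub>P\<^esub>" if "x \<in> bilinear_relators k M N" for x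
      using that
      by (auto simp: bilinear_relators_def Let_def minus add smult basis fl_basis lf
          bilinear_maps_closed[OF f] P.minus_eq P.r_neg)
    then show ?thesis using relators_carrier by blast
  qed
  ultimately have "bilinear_submodule k M N \<subseteq> ?K"
    unfolding bilinear_submodule_def by (intro hull_minimal)
  then show ?thesis using assms by auto
qed

text \<open>Independence of the choice made in \<open>tensor_lift\<close>: the representative picked
  by \<open>SOME\<close> differs from \<open>x\<close> by an element of the relation submodule, on
  which the free lift vanishes.\<close>

private lemma lift_pr:
  assumes x: "x \<in> carrier (tensor_free k M N)"
  shows "tensor_lift k P f (pr x) = fl x"
proof -
  interpret S: abelian_subgroup "bilinear_submodule k M N" "tensor_free k M N"
    by (rule submodule_abelian_subgroup[OF F.module_axioms submodule])
  define y where "y = (SOME y. y \<in> pr x)"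
  have "x \<in> pr x" using x by (rule S.a_rcos_self)
  then have "y \<in> pr x" unfolding y_def by (rule someI[of "\<lambda>y. y \<in> pr x"])
  then obtain h where h: "h \<in> bilinear_submodule k M N" "y = h \<oplus>\<^bsub>tensor_free k M N\<^esub> x"
    by (auto simp: a_r_coset_def')
  have "fl y = fl x"
    using h x S.a_subset by (auto simp: linear_maps_add[OF fl_linear] fl_relators linear_maps_closed[OF fl_linear])
  then show ?thesis by (simp add: tensor_lift_def y_def free_lift_def Let_def)
qed

lemma tensor_lift_linear: "tensor_lift k P f \<in> linear_maps k (tensor k M N) P"
proof (rule linear_mapsI)
  fix X c assume "X \<in> carrier (tensor k M N)" and c: "c \<in> carrier k"
  then obtain x where x: "X = pr x" "x \<in> carrier (tensor_free k M N)" by (auto simp: pr_surj)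
  show "tensor_lift k P f (c \<odot>\<^bsub>tensor k M N\<^esub> X) = c \<odot>\<^bsub>P\<^esub> tensor_lift k P f X"
    using x c by (simp add: lift_pr linear_maps_smult[OF pr_linear, symmetric] linear_maps_smult[OF fl_linear])
next
  fix X assume "X \<in> carrier (tensor k M N)"
  then show "tensor_lift k P f X \<in> carrier P"
    by (auto simp: pr_surj lift_pr intro: linear_maps_closed[OF fl_linear])
next
  fix X Y assume "X \<in> carrier (tensor k M N)" "Y \<in> carrier (tensor k M N)"
  then obtain x y where "X = pr x" "x \<in> carrier (tensor_free k M N)" "Y = pr y" "y \<in> carrier (tensor_free k M N)"
    by (auto simp: pr_surj)
  then show "tensor_lift k P f (X \<oplus>\<^bsub>tensor k M N\<^esub> Y) = tensor_lift k P f X \<oplus>\<^bsub>P\<^esub> tensor_lift k P f Y"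
    by (simp add: lift_pr linear_maps_add[OF pr_linear, symmetric] linear_maps_add[OF fl_linear])
qed

lemma tensor_lift_pure:
  "\<lbrakk>m \<in> carrier M; n \<in> carrier N\<rbrakk> \<Longrightarrow> tensor_lift k P f (pure_tensor k M N m n) = f m n"
  by (simp add: pure_tensor_def lift_pr basis fl_basis)

end

end

section \<open>Naturality of lifts, dependence on parameters and exchange of iterated lifts\<close>

lemma linear_maps_pure_left:
  assumes "module k M" "module k N" "f \<in> linear_maps k Q M" "n \<in> carrier N"
  shows "(\<lambda>q. pure_tensor k M N (f q) n) \<in> linear_maps k Q (tensor k M N)"
  by (rule linear_maps_comp[OF bilinear_maps_left[OF pure_tensor_bilinear]]) (rule assms)+

lemma linear_maps_pure_right:
  assumes "module k M" "module k N" "m \<in> carrier M" "f \<in> linear_maps k Q N"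
  shows "(\<lambda>q. pure_tensor k M N m (f q)) \<in> linear_maps k Q (tensor k M N)"
  by (rule linear_maps_comp[OF bilinear_maps_right[OF pure_tensor_bilinear]]) (rule assms)+

lemma tensor_lift_closed:
  assumes "module k M" "module k N" "module k P" "f \<in> bilinear_maps k M N P" "X \<in> carrier (tensor k M N)"
  shows "tensor_lift k P f X \<in> carrier P"
  by (rule linear_maps_closed[OF tensor_lift_linear]) (rule assms)+

lemma linear_maps_tensor_lift:
  assumes "module k M" "module k N" "module k P" "f \<in> bilinear_maps k M N P"
    "g \<in> linear_maps k Q (tensor k M N)"
  shows "(\<lambda>q. tensor_lift k P f (g q)) \<in> linear_maps k Q P"
  by (rule linear_maps_comp[OF tensor_lift_linear]) (rule assms)+

text \<open>Both sides are linear in \<open>X\<close> and agree on pure tensors. Bilinearity of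
  \<open>g\<close> is derived from its agreement with the composite on the carriers, so
  \<open>g\<close> may be any convenient rewriting of that composite.\<close>

lemma tensor_lift_hom:
  assumes M: "module k M" and N: "module k N" and P: "module k P" and Q: "module k Q"
    and h: "h \<in> linear_maps k P Q" and f: "f \<in> bilinear_maps k M N P"
    and g: "\<And>m n. \<lbrakk>m \<in> carrier M; n \<in> carrier N\<rbrakk> \<Longrightarrow> h (f m n) = g m n"
    and X: "X \<in> carrier (tensor k M N)"
  shows "h (tensor_lift k P f X) = tensor_lift k Q g X"
proof -
  have g_bil: "g \<in> bilinear_maps k M N Q"
  proof (rule bilinear_mapsI)
    fix m assume m: "m \<in> carrier M"
    show "(\<lambda>n. g m n) \<in> linear_maps k N Q"
      using linear_maps_comp[OF h bilinear_maps_right[OF f m]]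
      by (subst linear_maps_cong[OF N]) (auto simp: g[OF m, symmetric])
  next
    fix n assume n: "n \<in> carrier N"
    show "(\<lambda>m. g m n) \<in> linear_maps k M Q"
      using linear_maps_comp[OF h bilinear_maps_left[OF f n]]
      by (subst linear_maps_cong[OF M]) (auto simp: g[OF _ n, symmetric])
  qed
  show ?thesis
    by (rule tensor_ext[OF M N Q linear_maps_comp[OF h tensor_lift_linear[OF M N P f]]
          tensor_lift_linear[OF M N Q g_bil] _ X])
      (simp add: tensor_lift_pure[OF M N P f] tensor_lift_pure[OF M N Q g_bil] g)
qed

lemma tensor_lift_cong:
  assumes "module k M" "module k N" "module k P" "f \<in> bilinear_maps k M N P"
    and "\<And>m n. \<lbrakk>m \<in> carrier M; n \<in> carrier N\<rbrakk> \<Longrightarrow> f m n = g m n"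
    and "X \<in> carrier (tensor k M N)"
  shows "tensor_lift k P f X = tensor_lift k P g X"
  using tensor_lift_hom[OF assms(1-3,3) linear_maps_id assms(4-6)] .

text \<open>Here the tensor is fixed and the bilinear map varies. For fixed scalars and parameters,
  the two sides of each linearity law are themselves linear in \<open>X\<close>, so they are
  compared on pure tensors, where \<open>lin\<close> applies.\<close>

lemma tensor_lift_linear_param:
  assumes M: "module k M" and N: "module k N" and P: "module k P" and Q: "module k Q"
    and f: "\<And>q. q \<in> carrier Q \<Longrightarrow> F q \<in> bilinear_maps k M N P"
    and lin: "\<And>m n. \<lbrakk>m \<in> carrier M; n \<in> carrier N\<rbrakk> \<Longrightarrow> (\<lambda>q. F q m n) \<in> linear_maps k Q P"
    and X: "X \<in> carrier (tensor k M N)"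
  shows "(\<lambda>q. tensor_lift k P (F q) X) \<in> linear_maps k Q P"
proof -
  interpret P: module k P by (rule P)
  interpret Q: module k Q by (rule Q)
  note L = tensor_lift_linear[OF M N P f]
  show ?thesis
  proof (rule linear_mapsI)
    fix q assume q: "q \<in> carrier Q"
    show "tensor_lift k P (F q) X \<in> carrier P" by (rule linear_maps_closed[OF L[OF q] X])
    fix c assume c: "c \<in> carrier k"
    \<comment> \<open>Scaling a linear map by \<open>c\<close> is again linear because
      \<open>k\<close> is commutative.\<close>
    have "(\<lambda>X. c \<odot>\<^bsub>P\<^esub> tensor_lift k P (F q) X) \<in> linear_maps k (tensor k M N) P"
      using c by (intro linear_maps_comp[OF _ L[OF q]] linear_mapsI)
        (auto simp: P.smult_r_distr P.smult_assoc1[symmetric] P.R.m_comm)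
    then show "tensor_lift k P (F (c \<odot>\<^bsub>Q\<^esub> q)) X = c \<odot>\<^bsub>P\<^esub> tensor_lift k P (F q) X"
      using c q
      by (intro tensor_ext[OF M N P L _ _ X])
        (auto simp: tensor_lift_pure[OF M N P f] linear_maps_smult[OF lin])
  next
    fix q q' assume q: "q \<in> carrier Q" and q': "q' \<in> carrier Q"
    have "(\<lambda>X. tensor_lift k P (F q) X \<oplus>\<^bsub>P\<^esub> tensor_lift k P (F q') X) \<in> linear_maps k (tensor k M N) P"
      by (rule linear_mapsI)
        (auto simp: linear_maps_closed[OF L[OF q]] linear_maps_closed[OF L[OF q']]
          linear_maps_add[OF L[OF q]] linear_maps_add[OF L[OF q']]
          linear_maps_smult[OF L[OF q]] linear_maps_smult[OF L[OF q']]
          P.smult_r_distr P.a_ac)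
    then show "tensor_lift k P (F (q \<oplus>\<^bsub>Q\<^esub> q')) X = tensor_lift k P (F q) X \<oplus>\<^bsub>P\<^esub> tensor_lift k P (F q') X"
      using q q'
      by (intro tensor_ext[OF M N P L _ _ X])
        (auto simp: tensor_lift_pure[OF M N P f] linear_maps_add[OF lin])
  qed
qed

text \<open>A Fubini rule. Both sides are linear in \<open>Y\<close>; on a pure tensor the inner
  lift on the left and the outer lift on the right evaluate, leaving the same lift over
  \<open>X\<close>.\<close>

lemma tensor_lift_swap:
  assumes M: "module k M" and N: "module k N" and M': "module k M'" and N': "module k N'"
    and P: "module k P"
    and F1: "\<And>m n. \<lbrakk>m \<in> carrier M; n \<in> carrier N\<rbrakk> \<Longrightarrow> F m n \<in> bilinear_maps k M' N' P"
    and F2: "\<And>m' n'. \<lbrakk>m' \<in> carrier M'; n' \<in> carrier N'\<rbrakk>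
      \<Longrightarrow> (\<lambda>m n. F m n m' n') \<in> bilinear_maps k M N P"
    and X: "X \<in> carrier (tensor k M N)" and Y: "Y \<in> carrier (tensor k M' N')"
  shows "tensor_lift k P (\<lambda>m n. tensor_lift k P (F m n) Y) X =
    tensor_lift k P (\<lambda>m' n'. tensor_lift k P (\<lambda>m n. F m n m' n') X) Y"
proof -
  note T' = tensor_module[OF M' N']
  have lin: "(\<lambda>Y. tensor_lift k P (F m n) Y) \<in> linear_maps k (tensor k M' N') P"
    if "m \<in> carrier M" "n \<in> carrier N" for m n
    using tensor_lift_linear[OF M' N' P F1[OF that]] by simp
  \<comment> \<open>The tensor is arbitrary here, because the fact serves both for linearity in
    \<open>Y\<close> and for evaluation at pure tensors.\<close>
  have bilY: "(\<lambda>m n. tensor_lift k P (F m n) Y) \<in> bilinear_maps k M N P"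
    if Y: "Y \<in> carrier (tensor k M' N')" for Y
    by (intro bilinear_mapsI tensor_lift_linear_param[OF M' N' P _ _ _ Y] M N F1
        bilinear_maps_left[OF F2] bilinear_maps_right[OF F2])
  have bilX: "(\<lambda>m' n'. tensor_lift k P (\<lambda>m n. F m n m' n') X) \<in> bilinear_maps k M' N' P"
    by (intro bilinear_mapsI tensor_lift_linear_param[OF M N P _ _ _ X] M' N' F2
        bilinear_maps_left[OF F1] bilinear_maps_right[OF F1])
  show ?thesis
  proof (rule tensor_ext[OF M' N' P _ tensor_lift_linear[OF M' N' P bilX] _ Y])
    show "(\<lambda>Y. tensor_lift k P (\<lambda>m n. tensor_lift k P (F m n) Y) X) \<in> linear_maps k (tensor k M' N') P"
      by (intro tensor_lift_linear_param[OF M N P T' _ _ X] bilY lin)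
    fix m' n' assume mn': "m' \<in> carrier M'" "n' \<in> carrier N'"
    have "tensor_lift k P (\<lambda>m n. tensor_lift k P (F m n) (pure_tensor k M' N' m' n')) X =
        tensor_lift k P (\<lambda>m n. F m n m' n') X"
      by (intro tensor_lift_cong[OF M N P _ _ X] bilY pure_tensor_closed M' N' mn'
          tensor_lift_pure[OF M' N' P F1 mn'])
    then show "tensor_lift k P (\<lambda>m n. tensor_lift k P (F m n) (pure_tensor k M' N' m' n')) X =
        tensor_lift k P (\<lambda>m' n'. tensor_lift k P (\<lambda>m n. F m n m' n') X) (pure_tensor k M' N' m' n')"
      by (simp add: tensor_lift_pure[OF M' N' P bilX mn'])
  qed
qed

section \<open>Functoriality, the flip and the associativity maps\<close>

lemma tensor_map_bilinear:
  assumes "module k M'" "module k N'" "f \<in> linear_maps k M M'" "g \<in> linear_maps k N N'"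
  shows "(\<lambda>m n. pure_tensor k M' N' (f m) (g n)) \<in> bilinear_maps k M N (tensor k M' N')"
  using assms by (intro bilinear_mapsI linear_maps_pure_left linear_maps_pure_right)
    (auto intro: linear_maps_closed)

lemma tensor_map_linear:
  assumes "module k M" "module k N" "module k M'" "module k N'"
    "f \<in> linear_maps k M M'" "g \<in> linear_maps k N N'"
  shows "tensor_map k M' N' f g \<in> linear_maps k (tensor k M N) (tensor k M' N')"
  unfolding tensor_map_def
  by (intro tensor_lift_linear assms tensor_module tensor_map_bilinear)

lemma tensor_map_pure:
  assumes "module k M" "module k N" "module k M'" "module k N'"
    "f \<in> linear_maps k M M'" "g \<in> linear_maps k N N'" "m \<in> carrier M" "n \<in> carrier N"
  shows "tensor_map k M' N' f g (pure_tensor k M N m n) = pure_tensor k M' N' (f m) (g n)"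
  unfolding tensor_map_def
  by (rule tensor_lift_pure) (intro assms tensor_module tensor_map_bilinear)+

text \<open>Substitution in a lift: the lift of \<open>F\<close> is itself the linear map that is
  pulled inside the lift defining \<open>tensor_map\<close>.\<close>

lemma tensor_lift_map:
  assumes M: "module k M" and N: "module k N" and M': "module k M'" and N': "module k N'"
    and P: "module k P"
    and "f \<in> linear_maps k M M'" "g \<in> linear_maps k N N'" "F \<in> bilinear_maps k M' N' P"
    and "X \<in> carrier (tensor k M N)"
  shows "tensor_lift k P F (tensor_map k M' N' f g X) = tensor_lift k P (\<lambda>m n. F (f m) (g n)) X"
  unfolding tensor_map_def
  by (rule tensor_lift_hom[OF M N tensor_module[OF M' N'] P])
    (use assms in \<open>auto intro: tensor_lift_linear tensor_map_bilinear tensor_lift_pure linear_maps_closed\<close>)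

lemma tensor_swap_linear:
  assumes M: "module k M" and N: "module k N"
  shows "tensor_swap k M N \<in> linear_maps k (tensor k M N) (tensor k N M)"
    and "\<lbrakk>m \<in> carrier M; n \<in> carrier N\<rbrakk>
      \<Longrightarrow> tensor_swap k M N (pure_tensor k M N m n) = pure_tensor k N M n m"
proof -
  have "(\<lambda>m n. pure_tensor k N M n m) \<in> bilinear_maps k M N (tensor k N M)"
    by (intro bilinear_mapsI linear_maps_pure_left linear_maps_pure_right linear_maps_id assms)
  then show "tensor_swap k M N \<in> linear_maps k (tensor k M N) (tensor k N M)"
    and "\<lbrakk>m \<in> carrier M; n \<in> carrier N\<rbrakk>
      \<Longrightarrow> tensor_swap k M N (pure_tensor k M N m n) = pure_tensor k N M n m"
    unfolding tensor_swap_def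
    by (auto simp: tensor_lift_pure assms tensor_module intro: tensor_lift_linear)
qed

text \<open>Two lifts are nested. The inner one is linear in the tensor by the universal property
  and in \<open>p\<close> by linearity in a parameter, which is the bilinearity that the outer lift
  requires.\<close>

lemma tensor_assoc_linear:
  assumes M: "module k M" and N: "module k N" and P: "module k P"
  shows "tensor_assoc k M N P \<in> linear_maps k (tensor k (tensor k M N) P) (tensor k M (tensor k N P))"
    and "\<lbrakk>m \<in> carrier M; n \<in> carrier N; p \<in> carrier P\<rbrakk>
      \<Longrightarrow> tensor_assoc k M N P (pure_tensor k (tensor k M N) P (pure_tensor k M N m n) p) =
          pure_tensor k M (tensor k N P) m (pure_tensor k N P n p)"
proof -
  let ?T = "tensor k M (tensor k N P)"
  let ?f = "\<lambda>p m n. pure_tensor k M (tensor k N P) m (pure_tensor k N P n p)"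
  note T = tensor_module[OF M tensor_module[OF N P]]
  have inner: "?f p \<in> bilinear_maps k M N ?T" if "p \<in> carrier P" for p
    using that by (intro bilinear_mapsI linear_maps_pure_left linear_maps_pure_right linear_maps_id
        pure_tensor_closed tensor_module assms)
  have outer: "(\<lambda>x p. tensor_lift k ?T (?f p) x) \<in> bilinear_maps k (tensor k M N) P ?T"
    by (intro bilinear_mapsI tensor_lift_linear_param[OF M N T P] inner linear_maps_pure_right
        linear_maps_id tensor_lift_linear M N P T tensor_module)
  then show "tensor_assoc k M N P \<in> linear_maps k (tensor k (tensor k M N) P) ?T"
    unfolding tensor_assoc_def Let_def
    by (intro tensor_lift_linear M N P T tensor_module)
  show "tensor_assoc k M N P (pure_tensor k (tensor k M N) P (pure_tensor k M N m n) p) = ?f p m n"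
    if "m \<in> carrier M" "n \<in> carrier N" "p \<in> carrier P"
    using that
    by (simp add: tensor_assoc_def Let_def tensor_lift_pure[OF tensor_module[OF M N] P T outer]
        tensor_lift_pure[OF M N T inner] pure_tensor_closed M N)
qed

lemma tensor_assoc_inv_linear:
  assumes M: "module k M" and N: "module k N" and P: "module k P"
  shows "tensor_assoc_inv k M N P \<in> linear_maps k (tensor k M (tensor k N P)) (tensor k (tensor k M N) P)"
    and "\<lbrakk>m \<in> carrier M; n \<in> carrier N; p \<in> carrier P\<rbrakk>
      \<Longrightarrow> tensor_assoc_inv k M N P (pure_tensor k M (tensor k N P) m (pure_tensor k N P n p)) =
          pure_tensor k (tensor k M N) P (pure_tensor k M N m n) p"
proof -
  let ?T = "tensor k (tensor k M N) P"
  let ?f = "\<lambda>m n p. pure_tensor k (tensor k M N) P (pure_tensor k M N m n) p"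
  note T = tensor_module[OF tensor_module[OF M N] P]
  have inner: "?f m \<in> bilinear_maps k N P ?T" if "m \<in> carrier M" for m
    using that by (intro bilinear_mapsI linear_maps_pure_left linear_maps_pure_right linear_maps_id
        pure_tensor_closed tensor_module assms)
  have outer: "(\<lambda>m x. tensor_lift k ?T (?f m) x) \<in> bilinear_maps k M (tensor k N P) ?T"
    by (intro bilinear_mapsI tensor_lift_linear_param[OF N P T M] inner linear_maps_pure_left
        linear_maps_id tensor_lift_linear M N P T tensor_module)
  then show "tensor_assoc_inv k M N P \<in> linear_maps k (tensor k M (tensor k N P)) ?T"
    unfolding tensor_assoc_inv_def Let_def
    by (intro tensor_lift_linear M N P T tensor_module)
  show "tensor_assoc_inv k M N P (pure_tensor k M (tensor k N P) m (pure_tensor k N P n p)) = ?f m n p"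
    if "m \<in> carrier M" "n \<in> carrier N" "p \<in> carrier P"
    using that
    by (simp add: tensor_assoc_inv_def Let_def tensor_lift_pure[OF M tensor_module[OF N P] T outer]
        tensor_lift_pure[OF N P T inner] pure_tensor_closed N P)
qed

section \<open>The legs of an endomorphism of the tensor square\<close>

abbreviation pure_tensor3 where
  "pure_tensor3 k V u v w \<equiv> pure_tensor k (tensor k V V) V (pure_tensor k V V u v) w"

context
  fixes k :: "('k, 'r) ring_scheme" and V :: "('k, 'v, 'y) module_scheme"
  assumes V: "module k V"
begin

text \<open>Extensionality is used twice: first for the outer tensor product, then, with the last
  factor \<open>w\<close> fixed, for the inner one.\<close>

lemma tensor_cube_ext:
  assumes P: "module k P" and f: "f \<in> linear_maps k (tensor_cube k V) P"
    and g: "g \<in> linear_maps k (tensor_cube k V) P"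
    and eq: "\<And>u v w. \<lbrakk>u \<in> carrier V; v \<in> carrier V; w \<in> carrier V\<rbrakk>
      \<Longrightarrow> f (pure_tensor3 k V u v w) = g (pure_tensor3 k V u v w)"
    and x: "x \<in> carrier (tensor_cube k V)"
  shows "f x = g x"
proof (rule tensor_ext[OF tensor_module[OF V V] V P f g _ x])
  fix X w assume X: "X \<in> carrier (tensor k V V)" and w: "w \<in> carrier V"
  note lin = linear_maps_comp[OF _ linear_maps_pure_left[OF tensor_module[OF V V] V linear_maps_id w]]
  show "f (pure_tensor k (tensor k V V) V X w) = g (pure_tensor k (tensor k V V) V X w)"
    using w by (intro tensor_ext[OF V V P lin[OF f] lin[OF g] _ X]) (rule eq)
qed

lemma tensor_cube_module: "module k (tensor_cube k V)"
  by (intro tensor_module V)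

context
  fixes \<Omega>
  assumes \<Omega>: "\<Omega> \<in> linear_maps k (tensor k V V) (tensor k V V)"
begin

lemma leg12_linear: "leg12 k V \<Omega> \<in> linear_maps k (tensor_cube k V) (tensor_cube k V)"
  unfolding leg12_def by (intro tensor_map_linear tensor_module V \<Omega> linear_maps_id)

lemma leg12_pure:
  assumes "u \<in> carrier V" "v \<in> carrier V" "w \<in> carrier V"
  shows "leg12 k V \<Omega> (pure_tensor3 k V u v w) =
    pure_tensor k (tensor k V V) V (\<Omega> (pure_tensor k V V u v)) w"
  unfolding leg12_def
  by (rule tensor_map_pure) (intro tensor_module V \<Omega> linear_maps_id pure_tensor_closed assms)+

lemma leg23_linear: "leg23 k V \<Omega> \<in> linear_maps k (tensor_cube k V) (tensor_cube k V)"
  unfolding leg23_def comp_def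
  by (intro linear_maps_comp[OF tensor_assoc_inv_linear(1)] tensor_assoc_linear(1) V
      linear_maps_comp[OF tensor_map_linear[OF V tensor_module[OF V V] V tensor_module[OF V V]
          linear_maps_id \<Omega>]])

text \<open>The inverse associator stays unevaluated because \<Omega> of a pure tensor is in general
  a sum of pure tensors.\<close>

lemma leg23_pure:
  assumes "u \<in> carrier V" "v \<in> carrier V" "w \<in> carrier V"
  shows "leg23 k V \<Omega> (pure_tensor3 k V u v w) =
    tensor_assoc_inv k V V V (pure_tensor k V (tensor k V V) u (\<Omega> (pure_tensor k V V v w)))"
  unfolding leg23_def comp_def
  by (subst tensor_assoc_linear(2)[OF V V V assms], subst tensor_map_pure)
    (intro tensor_module V \<Omega> linear_maps_id pure_tensor_closed assms refl)+

end

lemma leg23_swap_pure: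
  assumes "u \<in> carrier V" "v \<in> carrier V" "w \<in> carrier V"
  shows "leg23 k V (tensor_swap k V V) (pure_tensor3 k V u v w) = pure_tensor3 k V u w v"
  using assms
  by (simp add: leg23_pure[OF tensor_swap_linear(1)] tensor_swap_linear(2) tensor_assoc_inv_linear(2) V)

lemma leg13_linear:
  assumes "\<Omega> \<in> linear_maps k (tensor k V V) (tensor k V V)"
  shows "leg13 k V \<Omega> \<in> linear_maps k (tensor_cube k V) (tensor_cube k V)"
  unfolding leg13_def comp_def
  by (intro linear_maps_comp[OF leg23_linear] linear_maps_comp[OF leg12_linear] leg23_linear
      tensor_swap_linear(1) V assms)

text \<open>Only the first flip acts on a pure tensor and can be evaluated; the second one meets the
  sum produced by \<Omega>.\<close>

lemma leg13_pure:
  assumes "u \<in> carrier V" "v \<in> carrier V" "w \<in> carrier V"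
  shows "leg13 k V \<Omega> (pure_tensor3 k V u v w) =
    leg23 k V (tensor_swap k V V) (leg12 k V \<Omega> (pure_tensor3 k V u w v))"
  using assms by (simp add: leg13_def leg23_swap_pure)

end

section \<open>Calculus of Sweedler sums\<close>

context right_module
begin

lemma modules: "module k A" "module k V"
  by (rule alg.module_axioms mod.module_axioms)+

lemma right_closed: "\<lbrakk>v \<in> carrier V; a \<in> carrier A\<rbrakk> \<Longrightarrow> r v a \<in> carrier V"
  by (rule linear_maps_closed[OF right_linear])

lemma linear_maps_right_action:
  "\<lbrakk>f \<in> linear_maps k Q V; a \<in> carrier A\<rbrakk> \<Longrightarrow> (\<lambda>q. r (f q) a) \<in> linear_maps k Q V"
  "\<lbrakk>v \<in> carrier V; g \<in> linear_maps k Q A\<rbrakk> \<Longrightarrow> (\<lambda>q. r v (g q)) \<in> linear_maps k Q V"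
  by (rule linear_maps_comp[OF right_linear] linear_maps_comp[OF right_linear_scalar]; assumption)+

lemma linear_maps_algebra_mult:
  "\<lbrakk>g \<in> linear_maps k Q A; a \<in> carrier A\<rbrakk> \<Longrightarrow> (\<lambda>q. g q \<otimes>\<^bsub>A\<^esub> a) \<in> linear_maps k Q A"
  "\<lbrakk>a \<in> carrier A; g \<in> linear_maps k Q A\<rbrakk> \<Longrightarrow> (\<lambda>q. a \<otimes>\<^bsub>A\<^esub> g q) \<in> linear_maps k Q A"
proof -
  have "(\<lambda>x. x \<otimes>\<^bsub>A\<^esub> a) \<in> linear_maps k A A" "(\<lambda>x. a \<otimes>\<^bsub>A\<^esub> x) \<in> linear_maps k A A"
    if "a \<in> carrier A"
    using that by (auto intro!: linear_mapsI simp: alg.smult_mult_left alg.smult_mult_right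
        alg.l_distr alg.r_distr)
  then show "\<lbrakk>g \<in> linear_maps k Q A; a \<in> carrier A\<rbrakk> \<Longrightarrow> (\<lambda>q. g q \<otimes>\<^bsub>A\<^esub> a) \<in> linear_maps k Q A"
    "\<lbrakk>a \<in> carrier A; g \<in> linear_maps k Q A\<rbrakk> \<Longrightarrow> (\<lambda>q. a \<otimes>\<^bsub>A\<^esub> g q) \<in> linear_maps k Q A"
    by (auto intro: linear_maps_comp)
qed

end

lemma (in central_bimodule) left_closed: "\<lbrakk>v \<in> carrier V; a \<in> carrier A\<rbrakk> \<Longrightarrow> l a v \<in> carrier V"
  by (rule linear_maps_closed[OF left_linear])

lemma (in central_bimodule) linear_maps_left_action:
  "\<lbrakk>a \<in> carrier A; f \<in> linear_maps k Q V\<rbrakk> \<Longrightarrow> (\<lambda>q. l a (f q)) \<in> linear_maps k Q V"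
  "\<lbrakk>g \<in> linear_maps k Q A; v \<in> carrier V\<rbrakk> \<Longrightarrow> (\<lambda>q. l (g q) v) \<in> linear_maps k Q V"
  by (rule linear_maps_comp[OF left_linear] linear_maps_comp[OF left_linear_scalar]; assumption)+

context sweedler_comodule
begin

lemma coaction_closed: "v \<in> carrier V \<Longrightarrow> \<rho> v \<in> carrier (tensor k V A)"
  by (rule linear_maps_closed[OF coaction_linear])

lemma sweedler_closed:
  "\<lbrakk>module k P; F \<in> bilinear_maps k V A P; v \<in> carrier V\<rbrakk> \<Longrightarrow> tensor_lift k P F (\<rho> v) \<in> carrier P"
  by (rule tensor_lift_closed[OF modules(2) modules(1)]) (assumption | rule coaction_closed)+

lemma sweedler_linear:
  "\<lbrakk>module k P; F \<in> bilinear_maps k V A P; f \<in> linear_maps k Q V\<rbrakk>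
    \<Longrightarrow> (\<lambda>q. tensor_lift k P F (\<rho> (f q))) \<in> linear_maps k Q P"
  by (intro linear_maps_tensor_lift[OF modules(2) modules(1)] linear_maps_comp[OF coaction_linear])

lemma sweedler_linear_param:
  assumes "module k P" "module k Q" "v \<in> carrier V"
    "\<And>q. q \<in> carrier Q \<Longrightarrow> F q \<in> bilinear_maps k V A P"
    "\<And>x b. \<lbrakk>x \<in> carrier V; b \<in> carrier A\<rbrakk> \<Longrightarrow> (\<lambda>q. F q x b) \<in> linear_maps k Q P"
  shows "(\<lambda>q. tensor_lift k P (F q) (\<rho> v)) \<in> linear_maps k Q P"
  by (rule tensor_lift_linear_param[OF modules(2) modules(1)]) (use assms coaction_closed in auto)

text \<open>With the linear map taken to be a leg, \<Omega> or \<rho>, this evaluates a composite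
  term by term under the Sweedler sum.\<close>

lemma sweedler_hom:
  assumes "module k P" "module k Q" "h \<in> linear_maps k P Q" "F \<in> bilinear_maps k V A P" "v \<in> carrier V"
    "\<And>x b. \<lbrakk>x \<in> carrier V; b \<in> carrier A\<rbrakk> \<Longrightarrow> h (F x b) = G x b"
  shows "h (tensor_lift k P F (\<rho> v)) = tensor_lift k Q G (\<rho> v)"
  by (rule tensor_lift_hom[OF modules(2) modules(1)]) (use assms coaction_closed in auto)

lemma sweedler_cong:
  assumes "module k P" "F \<in> bilinear_maps k V A P" "v \<in> carrier V"
    "\<And>x b. \<lbrakk>x \<in> carrier V; b \<in> carrier A\<rbrakk> \<Longrightarrow> F x b = G x b"
  shows "tensor_lift k P F (\<rho> v) = tensor_lift k P G (\<rho> v)"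
  by (rule sweedler_hom[OF assms(1,1) linear_maps_id assms(2-4)])

lemma sweedler_swap:
  assumes "module k P" "v \<in> carrier V" "w \<in> carrier V"
    "\<And>x b. \<lbrakk>x \<in> carrier V; b \<in> carrier A\<rbrakk> \<Longrightarrow> F x b \<in> bilinear_maps k V A P"
    "\<And>y c. \<lbrakk>y \<in> carrier V; c \<in> carrier A\<rbrakk> \<Longrightarrow> (\<lambda>x b. F x b y c) \<in> bilinear_maps k V A P"
  shows "tensor_lift k P (\<lambda>x b. tensor_lift k P (F x b) (\<rho> w)) (\<rho> v) =
    tensor_lift k P (\<lambda>y c. tensor_lift k P (\<lambda>x b. F x b y c) (\<rho> v)) (\<rho> w)"
  by (rule tensor_lift_swap[OF modules(2) modules(1) modules(2) modules(1)])
    (use assms coaction_closed in auto)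

lemma sweedler_right:
  assumes P: "module k P" and F: "F \<in> bilinear_maps k V A P" and v: "v \<in> carrier V" and a: "a \<in> carrier A"
  shows "tensor_lift k P F (\<rho> (r v a)) = tensor_lift k P (\<lambda>x b. F x (b \<otimes>\<^bsub>A\<^esub> a)) (\<rho> v)"
  unfolding coaction_right[OF v a]
  by (intro tensor_lift_map[OF modules(2) modules(1) modules(2) modules(1)] P F linear_maps_id
      linear_maps_algebra_mult coaction_closed v a)

text \<open>The coassociativity axiom is an equation in (V \<otimes> A) \<otimes> A. The hypotheses
  on \<open>F\<close> amount to trilinearity, so \<open>F\<close> can be evaluated on both sides of
  that equation; a coaction applied to the zeroth component is thereby replaced by \<one>.\<close>

lemma sweedler_coassoc:
  assumes P: "module k P" and v: "v \<in> carrier V"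
    and F1: "\<And>c. c \<in> carrier A \<Longrightarrow> (\<lambda>x b. F x b c) \<in> bilinear_maps k V A P"
    and F2: "\<And>x b. \<lbrakk>x \<in> carrier V; b \<in> carrier A\<rbrakk> \<Longrightarrow> F x b \<in> linear_maps k A P"
  shows "tensor_lift k P (\<lambda>y c. tensor_lift k P (\<lambda>x b. F x b c) (\<rho> y)) (\<rho> v) =
    tensor_lift k P (\<lambda>x c. F x \<one>\<^bsub>A\<^esub> c) (\<rho> v)"
proof -
  \<comment> \<open>Replacing \<rho> y by an arbitrary tensor \<open>X\<close> yields a bilinear
    map, which can be lifted along the two sides of the axiom.\<close>
  let ?G = "\<lambda>X c. tensor_lift k P (\<lambda>x b. F x b c) X"
  note VA = tensor_module[OF modules(2) modules(1)]
  have G: "?G \<in> bilinear_maps k (tensor k V A) A P"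
    by (intro bilinear_mapsI tensor_lift_linear_param[OF modules(2) modules(1)] modules P F1 F2
        tensor_lift_linear[OF modules(2) modules(1) P F1, simplified])
  have unit: "(\<lambda>u. pure_tensor k V A u \<one>\<^bsub>A\<^esub>) \<in> linear_maps k V (tensor k V A)"
    by (intro linear_maps_pure_left modules linear_maps_id alg.one_closed)
  have "tensor_lift k P (\<lambda>y c. ?G (\<rho> y) c) (\<rho> v) =
      tensor_lift k P ?G (tensor_map k (tensor k V A) A \<rho> (\<lambda>b. b) (\<rho> v))"
    by (intro tensor_lift_map[symmetric, OF modules(2) modules(1) VA modules(1) P] coaction_linear
        linear_maps_id G coaction_closed v)
  also have "\<dots> = tensor_lift k P ?G
      (tensor_map k (tensor k V A) A (\<lambda>u. pure_tensor k V A u \<one>\<^bsub>A\<^esub>) (\<lambda>b. b) (\<rho> v))"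
    using coassociative[OF v] by simp
  also have "\<dots> = tensor_lift k P (\<lambda>x c. ?G (pure_tensor k V A x \<one>\<^bsub>A\<^esub>) c) (\<rho> v)"
    by (intro tensor_lift_map[OF modules(2) modules(1) VA modules(1) P] unit linear_maps_id G
        coaction_closed v)
  also have "\<dots> = tensor_lift k P (\<lambda>x c. F x \<one>\<^bsub>A\<^esub> c) (\<rho> v)"
    by (rule sweedler_cong[OF P _ v])
      (auto intro!: bilinear_mapsI linear_maps_comp[OF bilinear_maps_left[OF G] unit]
        bilinear_maps_right[OF G] pure_tensor_closed modules tensor_lift_pure P F1)
  finally show ?thesis .
qed

end

section \<open>Yetter--Drinfeld modules\<close>

context yetter_drinfeld_module
begin

lemma sweedler_left:
  assumes P: "module k P" and F: "F \<in> bilinear_maps k V A P" and v: "v \<in> carrier V" and a: "a \<in> carrier A"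
  shows "tensor_lift k P F (\<rho> (l a v)) = tensor_lift k P (\<lambda>x b. F x (a \<otimes>\<^bsub>A\<^esub> b)) (\<rho> v)"
  unfolding coaction_left[OF v a]
  by (intro tensor_lift_map[OF modules(2) modules(1) modules(2) modules(1)] P F linear_maps_id
      linear_maps_algebra_mult coaction_closed v a)

text \<open>Used by repeated resolution, these rules split bilinearity into linearity in each
  variable and follow the variable to its place: inside a coaction by
  \<open>sweedler_linear\<close>, inside a summand by \<open>sweedler_linear_param\<close>.\<close>

lemmas linear_intros = bilinear_mapsI linear_maps_pure_left linear_maps_pure_right linear_maps_id
  linear_maps_left_action linear_maps_algebra_mult sweedler_linear sweedler_linear_param
  modules tensor_module pure_tensor_closed left_closed alg.m_closed alg.one_closed sweedler_closed

section \<open>The Yetter-Drinfeld operator and its legs as Sweedler sums\<close>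

abbreviation "\<Omega> \<equiv> yd_omega k V l \<rho>"

text \<open>This makes \<open>yd_omega\<close> well defined: \<open>v\<close> enters through the
  linear action and \<open>w\<close> through the linear coaction.\<close>

lemma yd_omega_pure_bilinear: "yd_omega_pure k V l \<rho> \<in> bilinear_maps k V V (tensor k V V)"
  unfolding yd_omega_pure_def tensor_map_def
  by (assumption | rule linear_intros)+

lemma yd_omega_linear: "\<Omega> \<in> linear_maps k (tensor k V V) (tensor k V V)"
  unfolding yd_omega_def
  by (intro tensor_lift_linear modules tensor_module yd_omega_pure_bilinear)

lemma yd_omega_pure_tensor:
  assumes "v \<in> carrier V" "w \<in> carrier V"
  shows "\<Omega> (pure_tensor k V V v w) = yd_omega_pure k V l \<rho> v w"
  unfolding yd_omega_def
  by (intro tensor_lift_pure modules tensor_module yd_omega_pure_bilinear assms)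

lemma yd_omega_sweedler:
  assumes "v \<in> carrier V" "w \<in> carrier V"
  shows "\<Omega> (pure_tensor k V V v w) = tensor_lift k (tensor k V V) (\<lambda>x b. pure_tensor k V V x (l b v)) (\<rho> w)"
  using assms by (simp add: yd_omega_pure_tensor yd_omega_pure_def tensor_map_def)

lemma leg12_sweedler:
  assumes u: "u \<in> carrier V" and v: "v \<in> carrier V" and w: "w \<in> carrier V"
  shows "leg12 k V \<Omega> (pure_tensor3 k V u v w) =
    tensor_lift k (tensor_cube k V) (\<lambda>x b. pure_tensor3 k V x (l b u) w) (\<rho> v)"
  unfolding leg12_pure[OF modules(2) yd_omega_linear u v w] yd_omega_sweedler[OF u v]
  by (rule sweedler_hom[where h = "\<lambda>X. pure_tensor k (tensor k V V) V X w"])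
    (assumption | rule linear_intros refl u v w)+

lemma leg23_sweedler:
  assumes u: "u \<in> carrier V" and v: "v \<in> carrier V" and w: "w \<in> carrier V"
  shows "leg23 k V \<Omega> (pure_tensor3 k V u v w) =
    tensor_lift k (tensor_cube k V) (\<lambda>x b. pure_tensor3 k V u x (l b v)) (\<rho> w)"
  unfolding leg23_pure[OF modules(2) yd_omega_linear u v w] yd_omega_sweedler[OF v w]
  by (rule sweedler_hom[where h = "\<lambda>X. tensor_assoc_inv k V V V (pure_tensor k V (tensor k V V) u X)"])
    (assumption | rule linear_maps_comp[OF tensor_assoc_inv_linear(1)] tensor_assoc_inv_linear(2)
      linear_intros u v w)+

lemma leg13_sweedler:
  assumes u: "u \<in> carrier V" and v: "v \<in> carrier V" and w: "w \<in> carrier V"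
  shows "leg13 k V \<Omega> (pure_tensor3 k V u v w) =
    tensor_lift k (tensor_cube k V) (\<lambda>x b. pure_tensor3 k V x v (l b u)) (\<rho> w)"
  unfolding leg13_pure[OF modules(2) u v w] leg12_sweedler[OF u w v]
  by (rule sweedler_hom)
    (assumption | rule leg23_linear[OF modules(2) tensor_swap_linear(1)] leg23_swap_pure linear_intros u v w)+

text \<open>Write (x, b) and (y, c) for the components of \<rho> w and \<rho> v. The successive
  values are u \<otimes> x \<otimes> bv, then y \<otimes> x \<otimes> (bc)u, then z \<otimes> dy
  \<otimes> (bc)u with (z, d) from \<rho> x; coassociativity for \<open>w\<close> turns (z, d) into
  (x, \<one>).\<close>

lemma leg12_leg13_leg23:
  assumes u: "u \<in> carrier V" and v: "v \<in> carrier V" and w: "w \<in> carrier V"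
  shows "leg12 k V \<Omega> (leg13 k V \<Omega> (leg23 k V \<Omega> (pure_tensor3 k V u v w))) =
    tensor_lift k (tensor_cube k V) (\<lambda>x b. tensor_lift k (tensor_cube k V)
      (\<lambda>y c. pure_tensor3 k V x y (l (b \<otimes>\<^bsub>A\<^esub> c) u)) (\<rho> v)) (\<rho> w)"
    (is "?lhs = _")
proof -
  let ?C = "tensor_cube k V"
  let ?L = "tensor_lift k ?C"
  note legs = leg12_linear[OF modules(2) yd_omega_linear] leg13_linear[OF modules(2) yd_omega_linear]
  have 13: "leg13 k V \<Omega> (pure_tensor3 k V u x (l b v)) =
      ?L (\<lambda>y c. pure_tensor3 k V y x (l (b \<otimes>\<^bsub>A\<^esub> c) u)) (\<rho> v)"
    if x: "x \<in> carrier V" and b: "b \<in> carrier A" for x b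
    unfolding leg13_sweedler[OF u x left_closed[OF v b]]
    by (rule sweedler_left) (assumption | rule linear_intros u v x b)+
  \<comment> \<open>The sums are exchanged so that the one over \<rho> x stands directly under the
    one over \<rho> w, the form in which coassociativity applies.\<close>
  have 12: "leg12 k V \<Omega> (?L (\<lambda>y c. pure_tensor3 k V y x (l (b \<otimes>\<^bsub>A\<^esub> c) u)) (\<rho> v)) =
      ?L (\<lambda>z d. ?L (\<lambda>y c. pure_tensor3 k V z (l d y) (l (b \<otimes>\<^bsub>A\<^esub> c) u)) (\<rho> v)) (\<rho> x)"
    if x: "x \<in> carrier V" and b: "b \<in> carrier A" for x b
  proof -
    have "leg12 k V \<Omega> (?L (\<lambda>y c. pure_tensor3 k V y x (l (b \<otimes>\<^bsub>A\<^esub> c) u)) (\<rho> v)) =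
        ?L (\<lambda>y c. ?L (\<lambda>z d. pure_tensor3 k V z (l d y) (l (b \<otimes>\<^bsub>A\<^esub> c) u)) (\<rho> x)) (\<rho> v)"
      by (rule sweedler_hom) (assumption | rule legs leg12_sweedler linear_intros u v x b)+
    also have "\<dots> = ?L (\<lambda>z d. ?L (\<lambda>y c. pure_tensor3 k V z (l d y) (l (b \<otimes>\<^bsub>A\<^esub> c) u)) (\<rho> v)) (\<rho> x)"
      by (rule sweedler_swap) (assumption | rule linear_intros u v x b)+
    finally show ?thesis .
  qed
  have "leg13 k V \<Omega> (leg23 k V \<Omega> (pure_tensor3 k V u v w)) =
      ?L (\<lambda>x b. ?L (\<lambda>y c. pure_tensor3 k V y x (l (b \<otimes>\<^bsub>A\<^esub> c) u)) (\<rho> v)) (\<rho> w)"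
    unfolding leg23_sweedler[OF u v w]
    by (rule sweedler_hom) (assumption | rule legs 13 linear_intros u v w)+
  then have "?lhs = leg12 k V \<Omega> (?L (\<lambda>x b. ?L (\<lambda>y c. pure_tensor3 k V y x (l (b \<otimes>\<^bsub>A\<^esub> c) u)) (\<rho> v)) (\<rho> w))"
    by simp
  also have "\<dots> = ?L (\<lambda>x b. ?L (\<lambda>z d. ?L (\<lambda>y c.
      pure_tensor3 k V z (l d y) (l (b \<otimes>\<^bsub>A\<^esub> c) u)) (\<rho> v)) (\<rho> x)) (\<rho> w)"
    by (rule sweedler_hom) (assumption | rule legs 12 linear_intros u v w)+
  also have "\<dots> = ?L (\<lambda>x b. ?L (\<lambda>y c. pure_tensor3 k V x (l \<one>\<^bsub>A\<^esub> y) (l (b \<otimes>\<^bsub>A\<^esub> c) u)) (\<rho> v)) (\<rho> w)"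
    by (rule sweedler_coassoc) (assumption | rule linear_intros u v w)+
  also have "\<dots> = ?L (\<lambda>x b. ?L (\<lambda>y c. pure_tensor3 k V x y (l (b \<otimes>\<^bsub>A\<^esub> c) u)) (\<rho> v)) (\<rho> w)"
    \<comment> \<open>The identity \<one>y = y holds only on the carrier, so it is applied through a
      congruence for each of the two nested sums.\<close>
    by (rule sweedler_cong, (assumption | rule linear_intros u v w)+, rule sweedler_cong)
      (assumption | rule linear_intros u v w | simp add: left_one)+
  finally show ?thesis .
qed

text \<open>In the same notation the values are y \<otimes> cu \<otimes> w, then x \<otimes> cu
  \<otimes> by, then x \<otimes> z \<otimes> (bd)(cu) with (z, d) now from \<rho> y. Coassociativity
  for \<open>v\<close> turns (z, d) into (y, \<one>).\<close>

lemma leg23_leg13_leg12: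
  assumes u: "u \<in> carrier V" and v: "v \<in> carrier V" and w: "w \<in> carrier V"
  shows "leg23 k V \<Omega> (leg13 k V \<Omega> (leg12 k V \<Omega> (pure_tensor3 k V u v w))) =
    tensor_lift k (tensor_cube k V) (\<lambda>x b. tensor_lift k (tensor_cube k V)
      (\<lambda>y c. pure_tensor3 k V x y (l (b \<otimes>\<^bsub>A\<^esub> c) u)) (\<rho> v)) (\<rho> w)"
    (is "?lhs = _")
proof -
  let ?C = "tensor_cube k V"
  let ?L = "tensor_lift k ?C"
  note legs = leg13_linear[OF modules(2) yd_omega_linear] leg23_linear[OF modules(2) yd_omega_linear]
  have 23: "leg23 k V \<Omega> (pure_tensor3 k V x (l c u) (l b y)) =
      ?L (\<lambda>z d. pure_tensor3 k V x z (l (b \<otimes>\<^bsub>A\<^esub> d) (l c u))) (\<rho> y)"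
    if x: "x \<in> carrier V" and y: "y \<in> carrier V" and b: "b \<in> carrier A" and c: "c \<in> carrier A" for x y b c
    unfolding leg23_sweedler[OF x left_closed[OF u c] left_closed[OF y b]]
    by (rule sweedler_left) (assumption | rule linear_intros u x y b c)+
  have step: "leg23 k V \<Omega> (?L (\<lambda>x b. pure_tensor3 k V x (l c u) (l b y)) (\<rho> w)) =
      ?L (\<lambda>z d. ?L (\<lambda>x b. pure_tensor3 k V x z (l (b \<otimes>\<^bsub>A\<^esub> d) (l c u))) (\<rho> w)) (\<rho> y)"
    if y: "y \<in> carrier V" and c: "c \<in> carrier A" for y c
  proof -
    have "leg23 k V \<Omega> (?L (\<lambda>x b. pure_tensor3 k V x (l c u) (l b y)) (\<rho> w)) =
        ?L (\<lambda>x b. ?L (\<lambda>z d. pure_tensor3 k V x z (l (b \<otimes>\<^bsub>A\<^esub> d) (l c u))) (\<rho> y)) (\<rho> w)"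
      by (rule sweedler_hom) (assumption | rule legs 23 linear_intros u w y c)+
    also have "\<dots> = ?L (\<lambda>z d. ?L (\<lambda>x b. pure_tensor3 k V x z (l (b \<otimes>\<^bsub>A\<^esub> d) (l c u))) (\<rho> w)) (\<rho> y)"
      by (rule sweedler_swap) (assumption | rule linear_intros u w y c)+
    finally show ?thesis .
  qed
  have "leg13 k V \<Omega> (leg12 k V \<Omega> (pure_tensor3 k V u v w)) =
      ?L (\<lambda>y c. ?L (\<lambda>x b. pure_tensor3 k V x (l c u) (l b y)) (\<rho> w)) (\<rho> v)"
    unfolding leg12_sweedler[OF u v w]
    by (rule sweedler_hom) (assumption | rule legs leg13_sweedler linear_intros u v w)+
  then have "?lhs = leg23 k V \<Omega> (?L (\<lambda>y c. ?L (\<lambda>x b. pure_tensor3 k V x (l c u) (l b y)) (\<rho> w)) (\<rho> v))"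
    by simp
  also have "\<dots> = ?L (\<lambda>y c. ?L (\<lambda>z d. ?L (\<lambda>x b.
      pure_tensor3 k V x z (l (b \<otimes>\<^bsub>A\<^esub> d) (l c u))) (\<rho> w)) (\<rho> y)) (\<rho> v)"
    by (rule sweedler_hom) (assumption | rule legs step linear_intros u v w)+
  also have "\<dots> = ?L (\<lambda>y c. ?L (\<lambda>x b. pure_tensor3 k V x y (l (b \<otimes>\<^bsub>A\<^esub> \<one>\<^bsub>A\<^esub>) (l c u))) (\<rho> w)) (\<rho> v)"
    by (rule sweedler_coassoc) (assumption | rule linear_intros u v w)+
  also have "\<dots> = ?L (\<lambda>y c. ?L (\<lambda>x b. pure_tensor3 k V x y (l (b \<otimes>\<^bsub>A\<^esub> c) u)) (\<rho> w)) (\<rho> v)"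
    by (rule sweedler_cong, (assumption | rule linear_intros u v w)+, rule sweedler_cong)
      (assumption | rule linear_intros u v w | simp add: left_mult u)+
  \<comment> \<open>The last exchange gives the two sums the order found for the other
    composite.\<close>
  also have "\<dots> = ?L (\<lambda>x b. ?L (\<lambda>y c. pure_tensor3 k V x y (l (b \<otimes>\<^bsub>A\<^esub> c) u)) (\<rho> v)) (\<rho> w)"
    by (rule sweedler_swap) (assumption | rule linear_intros u v w)+
  finally show ?thesis .
qed

text \<open>Both composites are linear on the cube, and on a pure tensor they have been reduced to
  the same double Sweedler sum.\<close>

lemma yd_omega_qybe: "qybe_solution k V \<Omega>"
  unfolding qybe_solution_def
proof (intro conjI ballI yd_omega_linear)
  fix x assume x: "x \<in> carrier (tensor_cube k V)"
  note legs = leg12_linear[OF modules(2) yd_omega_linear] leg13_linear[OF modules(2) yd_omega_linear]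
    leg23_linear[OF modules(2) yd_omega_linear]
  show "(leg12 k V \<Omega> \<circ> leg13 k V \<Omega> \<circ> leg23 k V \<Omega>) x = (leg23 k V \<Omega> \<circ> leg13 k V \<Omega> \<circ> leg12 k V \<Omega>) x"
    unfolding comp_def
    by (rule tensor_cube_ext[OF modules(2) tensor_cube_module[OF modules(2)] _ _ _ x])
      (auto simp: leg12_leg13_leg23 leg23_leg13_leg12
        intro!: linear_maps_comp[OF legs(1)] linear_maps_comp[OF legs(2)] linear_maps_comp[OF legs(3)] legs)
qed

text \<open>The hypothesis \<open>unit\<close> says that the first Sweedler component of
  \<open>v\<close> acting on the zeroth gives back \<open>v\<close>; the action derived from a
  comodule has this property.\<close>

lemma yd_omega_cube:
  assumes unit: "\<And>v. v \<in> carrier V \<Longrightarrow> tensor_lift k V (\<lambda>y c. l c y) (\<rho> v) = v"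
    and X: "X \<in> carrier (tensor k V V)"
  shows "\<Omega> (\<Omega> (\<Omega> X)) = \<Omega> X"
proof (rule tensor_ext[OF modules(2) modules(2) tensor_module[OF modules(2) modules(2)] _ yd_omega_linear _ X])
  show "(\<lambda>X. \<Omega> (\<Omega> (\<Omega> X))) \<in> linear_maps k (tensor k V V) (tensor k V V)"
    by (intro linear_maps_comp[OF yd_omega_linear] yd_omega_linear)
  fix v w assume v: "v \<in> carrier V" and w: "w \<in> carrier V"
  let ?T = "tensor k V V"
  let ?L = "tensor_lift k ?T"
  have 1: "\<Omega> (pure_tensor k V V x (l b u)) = ?L (\<lambda>y c. pure_tensor k V V y (l (b \<otimes>\<^bsub>A\<^esub> c) x)) (\<rho> u)"
    if x: "x \<in> carrier V" and b: "b \<in> carrier A" and u: "u \<in> carrier V" for x b u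
    unfolding yd_omega_sweedler[OF x left_closed[OF u b]]
    by (rule sweedler_left) (assumption | rule linear_intros u x b)+
  have 2: "\<Omega> (\<Omega> (pure_tensor k V V v w)) =
      ?L (\<lambda>x b. ?L (\<lambda>y c. pure_tensor k V V y (l (b \<otimes>\<^bsub>A\<^esub> c) x)) (\<rho> v)) (\<rho> w)"
    unfolding yd_omega_sweedler[OF v w]
    by (rule sweedler_hom) (assumption | rule yd_omega_linear 1 linear_intros v w)+
  have 3: "\<Omega> (?L (\<lambda>y c. pure_tensor k V V y (l (b \<otimes>\<^bsub>A\<^esub> c) x)) (\<rho> v)) =
      ?L (\<lambda>z d. ?L (\<lambda>y c. pure_tensor k V V z (l (b \<otimes>\<^bsub>A\<^esub> c \<otimes>\<^bsub>A\<^esub> d) y)) (\<rho> v)) (\<rho> x)"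
    if x: "x \<in> carrier V" and b: "b \<in> carrier A" for x b
  proof -
    have "\<Omega> (?L (\<lambda>y c. pure_tensor k V V y (l (b \<otimes>\<^bsub>A\<^esub> c) x)) (\<rho> v)) =
        ?L (\<lambda>y c. ?L (\<lambda>z d. pure_tensor k V V z (l (b \<otimes>\<^bsub>A\<^esub> c \<otimes>\<^bsub>A\<^esub> d) y)) (\<rho> x)) (\<rho> v)"
      by (rule sweedler_hom) (assumption | rule yd_omega_linear 1 linear_intros v x b)+
    also have "\<dots> = ?L (\<lambda>z d. ?L (\<lambda>y c. pure_tensor k V V z (l (b \<otimes>\<^bsub>A\<^esub> c \<otimes>\<^bsub>A\<^esub> d) y)) (\<rho> v)) (\<rho> x)"
      by (rule sweedler_swap) (assumption | rule linear_intros v x b)+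
    finally show ?thesis .
  qed
  \<comment> \<open>Multiplicativity gives (bc\<one>)y = b(cy), so \<open>unit\<close> sums up the
    part under \<open>b\<close>.\<close>
  have 4: "?L (\<lambda>y c. pure_tensor k V V x (l (b \<otimes>\<^bsub>A\<^esub> c \<otimes>\<^bsub>A\<^esub> \<one>\<^bsub>A\<^esub>) y)) (\<rho> v) = pure_tensor k V V x (l b v)"
    if x: "x \<in> carrier V" and b: "b \<in> carrier A" for x b
  proof -
    have "pure_tensor k V V x (l b (tensor_lift k V (\<lambda>y c. l c y) (\<rho> v))) =
        ?L (\<lambda>y c. pure_tensor k V V x (l (b \<otimes>\<^bsub>A\<^esub> c \<otimes>\<^bsub>A\<^esub> \<one>\<^bsub>A\<^esub>) y)) (\<rho> v)"
      by (rule sweedler_hom[where h = "\<lambda>X. pure_tensor k V V x (l b X)"])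
        (assumption | rule linear_intros v x b | simp add: left_mult b)+
    then show ?thesis using unit[OF v] by simp
  qed
  have "\<Omega> (\<Omega> (\<Omega> (pure_tensor k V V v w))) =
      ?L (\<lambda>x b. ?L (\<lambda>z d. ?L (\<lambda>y c. pure_tensor k V V z (l (b \<otimes>\<^bsub>A\<^esub> c \<otimes>\<^bsub>A\<^esub> d) y)) (\<rho> v)) (\<rho> x)) (\<rho> w)"
    unfolding 2 by (rule sweedler_hom) (assumption | rule yd_omega_linear 3 linear_intros v w)+
  \<comment> \<open>Coassociativity for \<open>w\<close> replaces (z, d) by (x, \<one>), which is
    the form treated in \<open>4\<close>.\<close>
  also have "\<dots> = ?L (\<lambda>x b. ?L (\<lambda>y c. pure_tensor k V V x (l (b \<otimes>\<^bsub>A\<^esub> c \<otimes>\<^bsub>A\<^esub> \<one>\<^bsub>A\<^esub>) y)) (\<rho> v)) (\<rho> w)"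
    by (rule sweedler_coassoc) (assumption | rule linear_intros v w)+
  also have "\<dots> = ?L (\<lambda>x b. pure_tensor k V V x (l b v)) (\<rho> w)"
    by (rule sweedler_cong) (assumption | rule 4 linear_intros v w)+
  finally show "\<Omega> (\<Omega> (\<Omega> (pure_tensor k V V v w))) = \<Omega> (pure_tensor k V V v w)"
    by (simp add: yd_omega_sweedler v w)
qed

end

section \<open>From comodules to Yetter--Drinfeld modules\<close>

context sweedler_comodule
begin

text \<open>This copies the inner lift of \<open>comodule_omega_pure\<close>, so the operator of a
  comodule is by unfolding the Yetter-Drinfeld operator of this action.\<close>

definition adjoint_action :: "'a \<Rightarrow> 'v \<Rightarrow> 'v" where
  "adjoint_action a v = tensor_lift k V (\<lambda>u b. r (r u a) b) (\<rho> v)"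

lemmas comodule_intros = bilinear_mapsI linear_maps_pure_left linear_maps_pure_right linear_maps_id
  linear_maps_right_action linear_maps_algebra_mult sweedler_linear sweedler_linear_param
  modules tensor_module pure_tensor_closed right_closed alg.m_closed alg.one_closed sweedler_closed

text \<open>Right linearity of \<rho> moves \<open>a\<close> and the outer component into the
  algebra factor; coassociativity then makes the inner component \<one>.\<close>

lemma coaction_adjoint:
  assumes v: "v \<in> carrier V" and a: "a \<in> carrier A"
  shows "\<rho> (adjoint_action a v) = tensor_map k V A (\<lambda>u. u) (\<lambda>b. a \<otimes>\<^bsub>A\<^esub> b) (\<rho> v)"
proof -
  let ?L = "tensor_lift k (tensor k V A)"
  have inner: "\<rho> (r (r u a) b) = ?L (\<lambda>y c. pure_tensor k V A y (c \<otimes>\<^bsub>A\<^esub> (a \<otimes>\<^bsub>A\<^esub> b))) (\<rho> u)"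
    if "u \<in> carrier V" "b \<in> carrier A" for u b
    using that a by (simp add: right_mult[symmetric] coaction_right tensor_map_def)
  have "\<rho> (adjoint_action a v) =
      ?L (\<lambda>u b. ?L (\<lambda>y c. pure_tensor k V A y (c \<otimes>\<^bsub>A\<^esub> (a \<otimes>\<^bsub>A\<^esub> b))) (\<rho> u)) (\<rho> v)"
    unfolding adjoint_action_def
    by (rule sweedler_hom) (assumption | rule inner comodule_intros coaction_linear v a)+
  also have "\<dots> = ?L (\<lambda>u b. pure_tensor k V A u (\<one>\<^bsub>A\<^esub> \<otimes>\<^bsub>A\<^esub> (a \<otimes>\<^bsub>A\<^esub> b))) (\<rho> v)"
    by (rule sweedler_coassoc) (assumption | rule comodule_intros v a)+
  also have "\<dots> = ?L (\<lambda>u b. pure_tensor k V A u (a \<otimes>\<^bsub>A\<^esub> b)) (\<rho> v)"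
    by (rule sweedler_cong) (assumption | rule comodule_intros v a | simp add: a)+
  finally show ?thesis by (simp add: tensor_map_def)
qed

text \<open>The counterpart of \<open>sweedler_left\<close>, available before the Yetter-Drinfeld
  axioms are established: multiplicativity of the action depends on it.\<close>

lemma sweedler_adjoint:
  assumes P: "module k P" and F: "F \<in> bilinear_maps k V A P" and v: "v \<in> carrier V" and a: "a \<in> carrier A"
  shows "tensor_lift k P F (\<rho> (adjoint_action a v)) = tensor_lift k P (\<lambda>x b. F x (a \<otimes>\<^bsub>A\<^esub> b)) (\<rho> v)"
  unfolding coaction_adjoint[OF v a]
  by (intro tensor_lift_map[OF modules(2) modules(1) modules(2) modules(1)] P F linear_maps_id
      linear_maps_algebra_mult coaction_closed v a)

text \<open>On the left the zeroth component is coacted on once more, with the new algebra component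
  multiplying on the right. Coassociativity replaces that component by \<one>.\<close>

lemma coaction_central_adjoint:
  assumes v: "v \<in> carrier V" and a: "a \<in> carrier A"
  shows "tensor_map k V A (\<lambda>u. adjoint_action a u) (\<lambda>b. b) (\<rho> v) =
    tensor_map k V A (\<lambda>u. r u a) (\<lambda>b. b) (\<rho> v)"
proof -
  let ?L = "tensor_lift k (tensor k V A)"
  have inner: "pure_tensor k V A (tensor_lift k V (\<lambda>y c. r (r y a) c) (\<rho> u)) b = ?L (\<lambda>y c. pure_tensor k V A (r (r y a) c) b) (\<rho> u)"
    if "u \<in> carrier V" "b \<in> carrier A" for u b
    by (rule sweedler_hom[where h = "\<lambda>X. pure_tensor k V A X b"])
      (assumption | rule comodule_intros refl that a)+
  have "?L (\<lambda>u b. pure_tensor k V A (adjoint_action a u) b) (\<rho> v) =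
      ?L (\<lambda>u b. ?L (\<lambda>y c. pure_tensor k V A (r (r y a) c) b) (\<rho> u)) (\<rho> v)"
    unfolding adjoint_action_def
    by (rule sweedler_cong) (assumption | rule inner comodule_intros v a)+
  also have "\<dots> = ?L (\<lambda>u b. pure_tensor k V A (r (r u a) \<one>\<^bsub>A\<^esub>) b) (\<rho> v)"
    by (rule sweedler_coassoc) (assumption | rule comodule_intros v a)+
  also have "\<dots> = ?L (\<lambda>u b. pure_tensor k V A (r u a) b) (\<rho> v)"
    by (rule sweedler_cong) (assumption | rule comodule_intros v a | simp add: right_one right_closed a)+
  finally show ?thesis by (simp add: tensor_map_def)
qed

lemma adjoint_action_yetter_drinfeld: "yetter_drinfeld_module k A V r adjoint_action \<rho>"
proof
  fix a assume a: "a \<in> carrier A"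
  show "adjoint_action a \<in> linear_maps k V V"
    unfolding adjoint_action_def by (assumption | rule comodule_intros a)+
next
  fix v assume v: "v \<in> carrier V"
  show "(\<lambda>a. adjoint_action a v) \<in> linear_maps k A V"
    unfolding adjoint_action_def by (assumption | rule comodule_intros v)+
  \<comment> \<open>For a = \<one> the action reduces to the counit axiom.\<close>
  have "tensor_lift k V r (\<rho> v) = adjoint_action \<one>\<^bsub>A\<^esub> v"
    unfolding adjoint_action_def
    by (rule sweedler_cong) (assumption | rule comodule_intros v | simp add: right_one)+
  then show "adjoint_action \<one>\<^bsub>A\<^esub> v = v" by (simp add: counital v)
next
  fix v a b assume v: "v \<in> carrier V" and a: "a \<in> carrier A" and b: "b \<in> carrier A"
  \<comment> \<open>The coaction of the inner result multiplies the algebra component by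
    \<open>b\<close> on the left, which places \<open>b\<close> right after
    \<open>a\<close>.\<close>
  have "adjoint_action a (adjoint_action b v) = tensor_lift k V (\<lambda>u c. r (r u a) (b \<otimes>\<^bsub>A\<^esub> c)) (\<rho> v)"
    unfolding adjoint_action_def[of a]
    by (rule sweedler_adjoint) (assumption | rule comodule_intros v a b)+
  also have "\<dots> = adjoint_action (a \<otimes>\<^bsub>A\<^esub> b) v"
    unfolding adjoint_action_def
    by (rule sweedler_cong) (assumption | rule comodule_intros v a b | simp add: right_mult right_closed a b)+
  finally show "adjoint_action (a \<otimes>\<^bsub>A\<^esub> b) v = adjoint_action a (adjoint_action b v)" by simp
  have "adjoint_action a (r v b) = tensor_lift k V (\<lambda>u c. r (r u a) (c \<otimes>\<^bsub>A\<^esub> b)) (\<rho> v)"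
    unfolding adjoint_action_def
    by (rule sweedler_right) (assumption | rule comodule_intros v a b)+
  moreover have "r (adjoint_action a v) b = tensor_lift k V (\<lambda>u c. r (r u a) (c \<otimes>\<^bsub>A\<^esub> b)) (\<rho> v)"
    unfolding adjoint_action_def
    by (rule sweedler_hom[where h = "\<lambda>X. r X b"])
      (assumption | rule comodule_intros v a b | simp add: right_mult right_closed a b)+
  ultimately show "r (adjoint_action a v) b = adjoint_action a (r v b)" by simp
qed (use coaction_adjoint coaction_central_adjoint in auto)

text \<open>Here the acting element \<open>c\<close> is the outer component of \<rho> v, inserted
  before the inner one. Coassociativity makes the inner one \<one>, and what remains is the counit
  axiom.\<close>

lemma adjoint_action_sweedler_self:
  assumes v: "v \<in> carrier V"
  shows "tensor_lift k V (\<lambda>y c. adjoint_action c y) (\<rho> v) = v"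
proof -
  have "tensor_lift k V (\<lambda>y c. adjoint_action c y) (\<rho> v) = tensor_lift k V (\<lambda>y c. r (r y c) \<one>\<^bsub>A\<^esub>) (\<rho> v)"
    unfolding adjoint_action_def
    by (rule sweedler_coassoc) (assumption | rule comodule_intros v)+
  also have "\<dots> = tensor_lift k V r (\<rho> v)"
    by (rule sweedler_cong) (assumption | rule comodule_intros v | simp add: right_one right_closed)+
  finally show ?thesis by (simp add: counital v)
qed

lemma comodule_omega_pure_eq: "comodule_omega_pure k V r \<rho> = yd_omega_pure k V adjoint_action \<rho>"
  by (simp add: fun_eq_iff comodule_omega_pure_def yd_omega_pure_def adjoint_action_def)

lemma comodule_omega_eq: "comodule_omega k V r \<rho> = yd_omega k V adjoint_action \<rho>"
  by (simp add: comodule_omega_def yd_omega_def comodule_omega_pure_eq)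

end

text \<open>The values on pure tensors are part of the claim because \<open>tensor_lift\<close> is
  meaningful only for bilinear maps; they certify that the operators are given by the intended
  formulas.\<close>

theorem theorem4p1:
  fixes k :: "('k, 'r) ring_scheme"
    and A :: "('k, 'a, 'x) module_scheme"
    and V :: "('k, 'v, 'y) module_scheme"
    and r :: "'v \<Rightarrow> 'a \<Rightarrow> 'v"
    and l :: "'a \<Rightarrow> 'v \<Rightarrow> 'v"
    and \<rho> :: "'v \<Rightarrow> ('v \<times> 'a \<Rightarrow> 'k) set"
  shows
    "(yetter_drinfeld_module k A V r l \<rho> \<longrightarrow>
        (\<forall>v\<in>carrier V. \<forall>w\<in>carrier V.
          yd_omega k V l \<rho> (pure_tensor k V V v w) = yd_omega_pure k V l \<rho> v w) \<and>
        qybe_solution k V (yd_omega k V l \<rho>)) \<and>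
     (sweedler_comodule k A V r \<rho> \<longrightarrow>
        (\<forall>v\<in>carrier V. \<forall>w\<in>carrier V.
          comodule_omega k V r \<rho> (pure_tensor k V V v w) = comodule_omega_pure k V r \<rho> v w) \<and>
        qybe_solution k V (comodule_omega k V r \<rho>) \<and>
        (\<forall>x\<in>carrier (tensor k V V).
          (comodule_omega k V r \<rho> ^^ 3) x = comodule_omega k V r \<rho> x))"
proof (intro conjI impI)
  assume "yetter_drinfeld_module k A V r l \<rho>"
  then interpret yetter_drinfeld_module k A V r l \<rho> .
  show "\<forall>v\<in>carrier V. \<forall>w\<in>carrier V. yd_omega k V l \<rho> (pure_tensor k V V v w) = yd_omega_pure k V l \<rho> v w"
    by (simp add: yd_omega_pure_tensor)
  show "qybe_solution k V (yd_omega k V l \<rho>)" by (rule yd_omega_qybe)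
next
  assume "sweedler_comodule k A V r \<rho>"
  then interpret C: sweedler_comodule k A V r \<rho> .
  \<comment> \<open>The comodule case is the Yetter-Drinfeld case for the adjoint action, with the
    same coaction.\<close>
  interpret yetter_drinfeld_module k A V r C.adjoint_action \<rho> by (rule C.adjoint_action_yetter_drinfeld)
  show "\<forall>v\<in>carrier V. \<forall>w\<in>carrier V.
      comodule_omega k V r \<rho> (pure_tensor k V V v w) = comodule_omega_pure k V r \<rho> v w"
    by (simp add: C.comodule_omega_eq C.comodule_omega_pure_eq yd_omega_pure_tensor)
  show "qybe_solution k V (comodule_omega k V r \<rho>)"
    unfolding C.comodule_omega_eq by (rule yd_omega_qybe)
  show "\<forall>x\<in>carrier (tensor k V V). (comodule_omega k V r \<rho> ^^ 3) x = comodule_omega k V r \<rho> x"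
    unfolding C.comodule_omega_eq
    by (simp add: numeral_3_eq_3 yd_omega_cube C.adjoint_action_sweedler_self)
qed

end
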